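(* Let $k \in \mathbb{N}$ and $n := 2^k$. Then $$f_{\max}(\mathbb{Z}_2^k) = \left( \binom{n-1}{2} + o(1) \right) 2^{n/4},$$ where $o(1)$ denotes a quantity tending to $0$ as $k \to \infty$ (equivalently, as $n\to\infty$).
   Context: $\mathbb{Z}_2^k = \mathbb{Z}_2 \times \cdots \times \mathbb{Z}_2$ ($k$ factors), as an additive group. For a finite abelian group $G$, a Schur triple is a triple $x,y,z \in G$ (not necessarily distinct) with $x+y=z$. A subset $A \subseteq G$ is sum-free if $A$ contains no Schur triples, i.e. there are no $x,y,z\in A$ with $x+y=z$. A maximal sum-free subset of $G$ is a sum-free set $A \subseteq G$ that is not properly contained in another sum-free subset of $G$. $f_{\max}(G)$ denotes the number of maximal sum-free subsets of $G$. *)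

theory Defs
  imports Complex_Main "HOL-Algebra.Product_Groups"
begin

text \<open>Groups are HOL-Algebra records, written multiplicatively: the sum \<open>x + y\<close> in an
  abelian group \<open>G\<close> is \<open>x \<otimes>\<^bsub>G\<^esub> y\<close>.\<close>

definition Z2_pow :: "nat \<Rightarrow> (nat \<Rightarrow> int) monoid" where
  "Z2_pow k = product_group {..<k} (\<lambda>_. integer_mod_group 2)"

text \<open>The elements \<open>x, y, z\<close> of a Schur triple need not be distinct.\<close>

definition schur_triple :: "('a, 'b) monoid_scheme \<Rightarrow> 'a \<Rightarrow> 'a \<Rightarrow> 'a \<Rightarrow> bool" where
  "schur_triple G x y z \<longleftrightarrow>
     x \<in> carrier G \<and> y \<in> carrier G \<and> z \<in> carrier G \<and> x \<otimes>\<^bsub>G\<^esub> y = z"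

definition sum_free :: "('a, 'b) monoid_scheme \<Rightarrow> 'a set \<Rightarrow> bool" where
  "sum_free G A \<longleftrightarrow>
     A \<subseteq> carrier G \<and> \<not> (\<exists>x\<in>A. \<exists>y\<in>A. \<exists>z\<in>A. schur_triple G x y z)"

definition maximal_sum_free :: "('a, 'b) monoid_scheme \<Rightarrow> 'a set \<Rightarrow> bool" where
  "maximal_sum_free G A \<longleftrightarrow> sum_free G A \<and> \<not> (\<exists>B. sum_free G B \<and> A \<subset> B)"

definition f_max :: "('a, 'b) monoid_scheme \<Rightarrow> nat" where
  "f_max G = card {A. maximal_sum_free G A}"

end

theory Submission
  imports Defs "HOL-Library.Z2" "HOL-Library.Function_Algebras" "HOL-Analysis.Convex"
begin

text \<open>
  Let \<open>n = 2^k\<close>, and write the group additively as \<open>V\<close>. The nontrivial characters \<open>r\<close> of \<open>V\<close> split it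
  into an even part (a subgroup of index 2) and an odd part (its other coset). Almost all maximal
  sum-free sets arise as follows: choose \<open>r\<close>, choose a nonzero even element \<open>s\<close>, and take \<open>s\<close> together
  with one element from each of the \<open>n/4\<close> pairs \<open>{x, x + s}\<close> of odd elements. There are
  \<open>(n - 1) * (n/2 - 1)\<close> pairs \<open>(r, s)\<close>, which is the binomial coefficient \<open>n - 1\<close> over 2, and
  \<open>2^(n/4)\<close> choices for each.

  For the upper bound, an arithmetic regularity lemma (\<open>arithmetic_regularity\<close>) places each sum-free
  set \<open>A\<close>, up to a small set \<open>C\<close>, inside a sum-free set \<open>B\<close> that is a union of cosets of a subgroup of
  bounded index (\<open>sumfree_structure\<close>). The number of possible \<open>B\<close> is polynomial in \<open>n\<close>, and that of
  possible \<open>C\<close> is at most \<open>(1 + h)^n\<close> with \<open>h\<close> as small as desired, so it remains to count the maximal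
  sum-free sets with given \<open>B\<close> and \<open>C\<close>. If \<open>A\<close> is maximal, \<open>A \<inter> B\<close> is a maximal independent set in the
  link graph of \<open>C\<close>, in which \<open>x\<close> and \<open>y\<close> are adjacent if \<open>x + y \<in> C\<close> (\<open>msf_mis_link\<close>). In characteristic
  2 this graph has no triangles because \<open>C\<close> is sum-free, and a triangle-free graph with \<open>m\<close> vertices has
  at most \<open>2^(m/2)\<close> maximal independent sets (\<open>triangle_free_graph.card_mis_le\<close>).

  If \<open>B\<close> has at most \<open>n/3\<close> elements, this gives about \<open>2^(n/6)\<close> sets, which is negligible. Otherwise a
  Fourier argument puts \<open>B\<close> inside an odd part (\<open>sumfree_large_subset_odd_part\<close>), so \<open>A\<close> has only few
  even elements. One even element gives the main term, where the link graph on the odd part is a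
  perfect matching. With two or more, this graph has degree at least 2 everywhere, and the number of
  maximal independent sets drops by an exponential factor (\<open>card_mis_link_odd_le\<close>), which outweighs the
  number of choices of the even elements.

  For the lower bound, a set formed from \<open>(r, s)\<close> as above is always sum-free, and it fails to be
  maximal only if its odd elements also alternate along pairs \<open>{x, x + t}\<close> for some \<open>t\<close> different from
  \<open>s\<close>, which is rare (\<open>card_one_even_ge\<close>). Only polynomially many sets are formed from two different pairs
  \<open>(r, s)\<close> (\<open>card_doubly_one_even_le\<close>).
\<close>

section \<open>Maximal independent sets in triangle-free graphs\<close>

definition mis :: "('a \<Rightarrow> 'a \<Rightarrow> bool) \<Rightarrow> 'a set \<Rightarrow> 'a set set" where
  "mis E W = {I. I \<subseteq> W \<and> (\<forall>x\<in>I. \<forall>y\<in>I. \<not> E x y) \<and> (\<forall>x\<in>W - I. \<exists>y\<in>I. E x y)}"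

definition closed_nbh :: "('a \<Rightarrow> 'a \<Rightarrow> bool) \<Rightarrow> 'a set \<Rightarrow> 'a set" where
  "closed_nbh E J = J \<union> {u. \<exists>v\<in>J. E v u}"

lemma finite_mis [simp]: "finite W \<Longrightarrow> finite (mis E W)"
  by (rule finite_subset[of _ "Pow W"]) (auto simp: mis_def)

lemma mis_independent: "I \<in> mis E W \<Longrightarrow> x \<in> I \<Longrightarrow> y \<in> I \<Longrightarrow> \<not> E x y"
  by (simp add: mis_def)

lemma mis_dominated: "I \<in> mis E W \<Longrightarrow> x \<in> W \<Longrightarrow> x \<notin> I \<Longrightarrow> \<exists>y\<in>I. E x y"
  by (simp add: mis_def)

text \<open>Taking \<open>x = y = z\<close> in the last assumption shows that it also excludes loops.\<close>

locale triangle_free_graph =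
  fixes E :: "'a \<Rightarrow> 'a \<Rightarrow> bool"
  assumes sym: "E x y \<Longrightarrow> E y x"
    and triangle_free: "E x y \<Longrightarrow> E y z \<Longrightarrow> E x z \<Longrightarrow> False"
begin

lemma irrefl: "\<not> E x x"
  using triangle_free by blast

text \<open>The branching step: a vertex with no neighbour in \<open>J\<close> has to be dominated by the rest of \<open>I\<close>,
  so fixing \<open>J \<subseteq> I\<close> removes the whole closed neighbourhood of \<open>J\<close> from the problem.\<close>

lemma mis_minus_closed_nbh:
  assumes "I \<in> mis E W" "J \<subseteq> I"
  shows "I - J \<in> mis E (W - closed_nbh E J)"
  using assms sym unfolding mis_def closed_nbh_def by blast

lemma card_mis_containing_le:
  assumes "finite W"
  shows "card {I \<in> mis E W. J \<subseteq> I} \<le> card (mis E (W - closed_nbh E J))"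
proof (rule card_inj_on_le)
  show "inj_on (\<lambda>I. I - J) {I \<in> mis E W. J \<subseteq> I}"
    by (rule inj_onI) blast
qed (use assms mis_minus_closed_nbh in auto)

lemma card_mis_avoiding_le:
  assumes "finite W"
  shows "card {I \<in> mis E W. v \<notin> I} \<le> card (mis E (W - {v}))"
  by (rule card_mono) (use assms in \<open>auto simp: mis_def\<close>)

lemma mis_dominates:
  assumes "I \<in> mis E W" "v \<in> W"
  shows "v \<in> I \<or> (\<exists>u\<in>W. E v u \<and> u \<in> I)"
  using assms unfolding mis_def by blast

text \<open>The bound of Hujter and Tuza, attained by perfect matchings. With \<open>s = sqrt 2\<close>, branching on
  membership of a vertex of degree at least 3 is affordable because \<open>1/s + 1/s^4 < 1\<close>. A vertex of
  degree at most 1 lies, with its neighbour, in a closed neighbourhood that every maximal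
  independent set meets, and \<open>2/s^2 = 1\<close>. Otherwise all degrees are 2, and three branches at a vertex
  and one of its neighbours remove 3, 3 and 4 vertices, with \<open>2/s^3 + 1/s^4 < 1\<close>; the last branch is
  where triangles must be absent.\<close>

theorem card_mis_le:
  assumes "finite W"
  shows "real (card (mis E W)) \<le> sqrt 2 ^ card W"
  using assms
proof (induction "card W" arbitrary: W rule: less_induct)
  case less
  note fin = \<open>finite W\<close>
  let ?s = "sqrt 2" and ?m = "card W"
  have s1: "1 \<le> ?s" by simp
  have s2: "?s * ?s = 2" by simp
  have s32: "?s \<le> 3/2"
    by (rule real_le_lsqrt) (auto simp: power2_eq_square)
  have smaller: "real (card (mis E W')) \<le> ?s ^ (?m - j)"
    if "W' \<subseteq> W" "card W' \<le> ?m - j" "0 < j" "j \<le> ?m" for W' j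
  proof -
    have "card W' < ?m" using that by linarith
    with less(1)[of W'] that fin have "real (card (mis E W')) \<le> ?s ^ card W'"
      using finite_subset by blast
    also have "\<dots> \<le> ?s ^ (?m - j)" using that s1 by (intro power_increasing) auto
    finally show ?thesis .
  qed
  have containing: "real (card {I \<in> mis E W. J \<subseteq> I}) \<le> ?s ^ (?m - card D) \<and> card D \<le> ?m"
    if "D \<subseteq> W" "D \<subseteq> closed_nbh E J" "D \<noteq> {}" for J D
  proof -
    have "finite D" using that fin finite_subset by blast
    have "card (W - closed_nbh E J) \<le> card (W - D)"
      using that fin by (intro card_mono) auto
    also have "\<dots> = ?m - card D" using that \<open>finite D\<close> by (simp add: card_Diff_subset)
    finally have "real (card (mis E (W - closed_nbh E J))) \<le> ?s ^ (?m - card D)"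
      using that \<open>finite D\<close> fin by (intro smaller) (auto simp: card_gt_0_iff card_mono)
    moreover have "card D \<le> ?m" using that fin by (simp add: card_mono)
    ultimately show ?thesis using card_mis_containing_le[OF fin, of J] by linarith
  qed
  have split: "?s ^ ?m = ?s ^ (?m - j) * ?s ^ j" if "j \<le> ?m" for j
    using that by (simp flip: power_add)
  have pw: "?s ^ 2 = 2" "?s ^ 3 = 2 * ?s" "?s ^ 4 = 4"
    using s2 by (simp_all add: eval_nat_numeral)
  have split1: "?s ^ (?m - 1) = ?s ^ (?m - 4) * ?s ^ 3" if "4 \<le> ?m"
  proof -
    have "?m - 1 = (?m - 4) + 3" using that by simp
    then show ?thesis by (simp only: power_add)
  qed
  have split3: "?s ^ (?m - 3) = ?s ^ (?m - 4) * ?s" if "4 \<le> ?m"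
  proof -
    have "?m - 3 = (?m - 4) + 1" using that by simp
    then show ?thesis by (simp only: power_add power_one_right)
  qed
  define N where "N v = {u \<in> W. E v u}" for v
  have finN: "finite (N v)" for v using fin by (auto simp: N_def)
  have N_irrefl: "v \<notin> N v" for v using irrefl by (auto simp: N_def)
  have N_sub: "N v \<subseteq> W" for v by (auto simp: N_def)
  consider (empty) "W = {}" | (high) v where "v \<in> W" "3 \<le> card (N v)"
    | (isolated) v where "v \<in> W" "card (N v) = 0"
    | (leaf) v where "v \<in> W" "card (N v) = 1"
    | (two) "W \<noteq> {}" "\<And>v. v \<in> W \<Longrightarrow> card (N v) = 2"
  proof -
    have "d = 0 \<or> d = 1 \<or> d = 2 \<or> 3 \<le> d" for d :: nat by arith
    then show thesis using that by metis
  qed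
  then show ?case
  proof cases
    case empty
    then have "mis E W = {{}}" by (auto simp: mis_def)
    with empty show ?thesis by simp
  next
    case (high v)
    let ?D = "insert v (N v)"
    have cD: "4 \<le> card ?D" using high finN N_irrefl by simp
    have c: "real (card {I \<in> mis E W. {v} \<subseteq> I}) \<le> ?s ^ (?m - card ?D) \<and> card ?D \<le> ?m"
      using high N_sub by (intro containing) (auto simp: closed_nbh_def N_def)
    then have m4: "4 \<le> ?m" using cD by linarith
    have c4: "real (card {I \<in> mis E W. v \<in> I}) \<le> ?s ^ (?m - 4)"
    proof -
      have "?s ^ (?m - card ?D) \<le> ?s ^ (?m - 4)" using cD s1 by (intro power_increasing) auto
      moreover have "real (card {I \<in> mis E W. v \<in> I}) \<le> ?s ^ (?m - card ?D)" using c by simp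
      ultimately show ?thesis by linarith
    qed
    have a: "real (card {I \<in> mis E W. v \<notin> I}) \<le> ?s ^ (?m - 1)"
    proof -
      have "real (card (mis E (W - {v}))) \<le> ?s ^ (?m - 1)"
        using high fin m4 by (intro smaller) auto
      then show ?thesis using card_mis_avoiding_le[OF fin, of v] by linarith
    qed
    have "mis E W = {I \<in> mis E W. v \<in> I} \<union> {I \<in> mis E W. v \<notin> I}" by blast
    then have "card (mis E W) \<le> card {I \<in> mis E W. v \<in> I} + card {I \<in> mis E W. v \<notin> I}"
      by (metis card_Un_le)
    then have "real (card (mis E W)) \<le> ?s ^ (?m - 4) + ?s ^ (?m - 1)"
      using c4 a by linarith
    also have "\<dots> = ?s ^ (?m - 4) * (1 + 2 * ?s)"
      using split1[OF m4] pw by (simp add: algebra_simps)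
    also have "\<dots> \<le> ?s ^ (?m - 4) * 4" using s32 by (intro mult_left_mono) auto
    also have "\<dots> = ?s ^ ?m" using split[OF m4] pw by simp
    finally show ?thesis .
  next
    case (isolated v)
    have "N v = {}" using isolated finN by simp
    then have "mis E W \<subseteq> {I \<in> mis E W. {v} \<subseteq> I}"
      using mis_dominates isolated(1) unfolding N_def by blast
    then have "card (mis E W) \<le> card {I \<in> mis E W. {v} \<subseteq> I}"
      using fin by (intro card_mono) auto
    moreover have "real (card {I \<in> mis E W. {v} \<subseteq> I}) \<le> ?s ^ (?m - card {v}) \<and> card {v} \<le> ?m"
      using isolated by (intro containing) (auto simp: closed_nbh_def)
    moreover have "?s ^ (?m - card {v}) \<le> ?s ^ ?m" using s1 by (intro power_increasing) auto
    ultimately show ?thesis by linarith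
  next
    case (leaf v)
    then obtain u where u: "N v = {u}" by (auto simp: card_1_singleton_iff)
    have uv: "u \<in> W" "E v u" "E u v" "u \<noteq> v" using u sym irrefl by (auto simp: N_def)
    have "mis E W \<subseteq> {I \<in> mis E W. {v} \<subseteq> I} \<union> {I \<in> mis E W. {u} \<subseteq> I}"
    proof
      fix I assume "I \<in> mis E W"
      moreover from this have "v \<in> I \<or> u \<in> I" using mis_dominates[of I W v] leaf(1) u by (auto simp: N_def)
      ultimately show "I \<in> {I \<in> mis E W. {v} \<subseteq> I} \<union> {I \<in> mis E W. {u} \<subseteq> I}" by blast
    qed
    then have "card (mis E W) \<le> card ({I \<in> mis E W. {v} \<subseteq> I} \<union> {I \<in> mis E W. {u} \<subseteq> I})"
      using fin by (intro card_mono) auto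
    also have "\<dots> \<le> card {I \<in> mis E W. {v} \<subseteq> I} + card {I \<in> mis E W. {u} \<subseteq> I}"
      by (rule card_Un_le)
    finally have "card (mis E W) \<le> card {I \<in> mis E W. {v} \<subseteq> I} + card {I \<in> mis E W. {u} \<subseteq> I}" .
    moreover have "real (card {I \<in> mis E W. {v} \<subseteq> I}) \<le> ?s ^ (?m - card {u, v}) \<and> card {u, v} \<le> ?m"
      using leaf uv by (intro containing) (auto simp: closed_nbh_def)
    moreover have "real (card {I \<in> mis E W. {u} \<subseteq> I}) \<le> ?s ^ (?m - card {u, v}) \<and> card {u, v} \<le> ?m"
      using leaf uv by (intro containing) (auto simp: closed_nbh_def)
    moreover have "card {u, v} = 2" using uv by simp
    ultimately show ?thesis using split[of 2] pw by simp
  next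
    case two
    then obtain v where v: "v \<in> W" by blast
    obtain u w where uw: "N v = {u, w}" "u \<noteq> w" using two v by (meson card_2_iff)
    have uW: "u \<in> W" "w \<in> W" "E v u" "E v w" using uw by (auto simp: N_def)
    have "v \<in> N u" using uW v sym by (auto simp: N_def)
    moreover obtain a b where "N u = {a, b}" "a \<noteq> b" using two uW by (meson card_2_iff)
    ultimately obtain t where t: "N u = {v, t}" "t \<noteq> v" by (metis doubleton_eq_iff insertE singletonD)
    have tW: "t \<in> W" "E u t" using t by (auto simp: N_def)
    have ne: "t \<noteq> w" "u \<noteq> v" "w \<noteq> v" "t \<noteq> u"
      using uW tW irrefl triangle_free by metis+
    \<comment> \<open>A set avoiding \<open>v\<close> and its neighbour \<open>u\<close> dominates \<open>v\<close> through \<open>w\<close> and \<open>u\<close> through \<open>t\<close>.\<close>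
    have "mis E W \<subseteq> {I \<in> mis E W. {v} \<subseteq> I} \<union> ({I \<in> mis E W. {u} \<subseteq> I} \<union> {I \<in> mis E W. {w, t} \<subseteq> I})"
    proof
      fix I assume I: "I \<in> mis E W"
      have "v \<in> I \<or> u \<in> I \<or> w \<in> I" using mis_dominates[OF I v] uw by (auto simp: N_def)
      moreover have "u \<in> I \<or> v \<in> I \<or> t \<in> I" using mis_dominates[OF I uW(1)] t by (auto simp: N_def)
      ultimately show "I \<in> {I \<in> mis E W. {v} \<subseteq> I} \<union> ({I \<in> mis E W. {u} \<subseteq> I} \<union> {I \<in> mis E W. {w, t} \<subseteq> I})"
        using I by blast
    qed
    then have "card (mis E W) \<le> card ({I \<in> mis E W. {v} \<subseteq> I} \<union> ({I \<in> mis E W. {u} \<subseteq> I} \<union> {I \<in> mis E W. {w, t} \<subseteq> I}))"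
      using fin by (intro card_mono) auto
    also have "\<dots> \<le> card {I \<in> mis E W. {v} \<subseteq> I} + (card {I \<in> mis E W. {u} \<subseteq> I} + card {I \<in> mis E W. {w, t} \<subseteq> I})"
      by (meson card_Un_le add_left_mono order_trans)
    finally have "card (mis E W) \<le> card {I \<in> mis E W. {v} \<subseteq> I} + (card {I \<in> mis E W. {u} \<subseteq> I} + card {I \<in> mis E W. {w, t} \<subseteq> I})" .
    moreover have "real (card {I \<in> mis E W. {v} \<subseteq> I}) \<le> ?s ^ (?m - card {v, u, w}) \<and> card {v, u, w} \<le> ?m"
      using uW v by (intro containing) (auto simp: closed_nbh_def)
    moreover have "real (card {I \<in> mis E W. {u} \<subseteq> I}) \<le> ?s ^ (?m - card {u, v, t}) \<and> card {u, v, t} \<le> ?m"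
      using uW v tW sym by (intro containing) (auto simp: closed_nbh_def)
    moreover have "real (card {I \<in> mis E W. {w, t} \<subseteq> I}) \<le> ?s ^ (?m - card {w, t, v, u}) \<and> card {w, t, v, u} \<le> ?m"
      using uW v tW sym by (intro containing) (auto simp: closed_nbh_def)
    moreover have "card {v, u, w} = 3" "card {u, v, t} = 3" "card {w, t, v, u} = 4"
      using ne uw t by auto
    ultimately have le: "real (card (mis E W)) \<le> ?s ^ (?m - 3) + ?s ^ (?m - 3) + ?s ^ (?m - 4)"
      and m4: "4 \<le> ?m" by auto
    note le
    also have "?s ^ (?m - 3) + ?s ^ (?m - 3) + ?s ^ (?m - 4) = ?s ^ (?m - 4) * (1 + 2 * ?s)"
      using split3[OF m4] by (simp add: algebra_simps)
    also have "\<dots> \<le> ?s ^ (?m - 4) * 4" using s32 by (intro mult_left_mono) auto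
    also have "\<dots> = ?s ^ ?m" using split[OF m4] pw by simp
    finally show ?thesis .
  qed
qed

text \<open>An exponential saving over \<open>card_mis_le\<close> for graphs far from matchings. While more than \<open>w0\<close>
  vertices remain, branch on a vertex of degree at least 3: this costs a factor \<open>b = 7/5 < sqrt 2\<close> per
  vertex, since \<open>1/b + 1/b^4 < 1\<close>. The remaining \<open>w0\<close> vertices are left to the general bound.\<close>

lemma card_mis_le_of_degree_ge_3:
  assumes "finite W"
    and deg: "\<And>U. U \<subseteq> W \<Longrightarrow> w0 < card U \<Longrightarrow> \<exists>v\<in>U. 3 \<le> card {u \<in> U. E v u}"
    and "w0 \<le> card W"
  shows "real (card (mis E W)) \<le> sqrt 2 ^ w0 * (7/5) ^ (card W - w0)"
proof -
  let ?s = "sqrt 2" and ?b = "7/5 :: real"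
  have bs: "?b \<le> ?s" by (rule real_le_rsqrt) (simp add: power2_eq_square)
  have *: "real (card (mis E U)) * ?b ^ w0 \<le> ?s ^ w0 * ?b ^ card U" if "U \<subseteq> W" for U
    using that
  proof (induction "card U" arbitrary: U rule: less_induct)
    case less
    have fin: "finite U" using less(2) assms(1) finite_subset by blast
    show ?case
    proof (cases "card U \<le> w0")
      case True
      then obtain e where e: "w0 = card U + e" using le_Suc_ex by blast
      have "real (card (mis E U)) * ?b ^ w0 \<le> ?s ^ card U * ?b ^ w0"
        using card_mis_le[OF fin] by (intro mult_right_mono) auto
      also have "\<dots> = ?s ^ card U * ?b ^ card U * ?b ^ e" by (simp add: e power_add)
      also have "\<dots> \<le> ?s ^ card U * ?b ^ card U * ?s ^ e"
        using bs by (intro mult_left_mono power_mono) auto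
      also have "\<dots> = ?s ^ w0 * ?b ^ card U" by (simp add: e power_add)
      finally show ?thesis .
    next
      case False
      then obtain v where v: "v \<in> U" "3 \<le> card {u \<in> U. E v u}" using deg[OF less(2)] by auto
      let ?D = "insert v {u \<in> U. E v u}" and ?U' = "U - closed_nbh E {v}"
      have D: "4 \<le> card ?D" using v fin irrefl by simp
      have U': "?U' = U - ?D" by (auto simp: closed_nbh_def)
      have DU: "?D \<subseteq> U" using v by auto
      then have "card ?D \<le> card U" using fin by (rule card_mono[rotated])
      then have m4: "4 \<le> card U" using D by linarith
      have cU': "card ?U' \<le> card U - 4"
        unfolding U' using D DU fin by (subst card_Diff_subset) (auto intro: finite_subset)
      have cU1: "card (U - {v}) = card U - 1" using v fin by simp
      have 1: "real (card (mis E (U - {v}))) * ?b ^ w0 \<le> ?s ^ w0 * ?b ^ (card U - 1)"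
        using less(1)[of "U - {v}"] cU1 m4 less(2) by fastforce
      have "real (card (mis E ?U')) * ?b ^ w0 \<le> ?s ^ w0 * ?b ^ card ?U'"
        using cU' m4 less(2) by (intro less(1)) auto
      also have "\<dots> \<le> ?s ^ w0 * ?b ^ (card U - 4)"
        using cU' by (intro mult_left_mono power_increasing) auto
      finally have 2: "real (card (mis E ?U')) * ?b ^ w0 \<le> ?s ^ w0 * ?b ^ (card U - 4)" .
      have "mis E U = {I \<in> mis E U. {v} \<subseteq> I} \<union> {I \<in> mis E U. v \<notin> I}" by blast
      then have "card (mis E U) \<le> card {I \<in> mis E U. {v} \<subseteq> I} + card {I \<in> mis E U. v \<notin> I}"
        by (metis card_Un_le)
      also have "\<dots> \<le> card (mis E ?U') + card (mis E (U - {v}))"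
        by (intro add_mono card_mis_containing_le card_mis_avoiding_le fin)
      finally have "real (card (mis E U)) \<le> real (card (mis E ?U')) + real (card (mis E (U - {v})))"
        by linarith
      then have "real (card (mis E U)) * ?b ^ w0
          \<le> (real (card (mis E ?U')) + real (card (mis E (U - {v})))) * ?b ^ w0"
        by (intro mult_right_mono) auto
      also have "\<dots> \<le> ?s ^ w0 * ?b ^ (card U - 4) + ?s ^ w0 * ?b ^ (card U - 1)"
        using 1 2 by (simp add: algebra_simps)
      also have "\<dots> = ?s ^ w0 * ?b ^ (card U - 4) * (1 + ?b ^ 3)"
      proof -
        have "card U - 1 = (card U - 4) + 3" using m4 by simp
        then show ?thesis by (simp only: power_add) (simp add: algebra_simps)
      qed
      also have "\<dots> \<le> ?s ^ w0 * ?b ^ (card U - 4) * ?b ^ 4"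
        by (intro mult_left_mono) (auto simp: eval_nat_numeral)
      also have "\<dots> = ?s ^ w0 * ?b ^ card U"
      proof -
        have "card U = (card U - 4) + 4" using m4 by simp
        then show ?thesis by (metis power_add mult.assoc)
      qed
      finally show ?thesis .
    qed
  qed
  have "real (card (mis E W)) * ?b ^ w0 \<le> ?s ^ w0 * ?b ^ card W" by (rule *) simp
  also have "\<dots> = (?s ^ w0 * ?b ^ (card W - w0)) * ?b ^ w0"
    using assms(3) by (simp flip: power_add)
  finally show ?thesis by (simp add: mult_le_cancel_right)
qed

end

section \<open>Fourier analysis on elementary abelian 2-groups\<close>

text \<open>An elementary abelian 2-group \<open>V\<close> identified with its own dual: \<open>chr r\<close> is the character with
  index \<open>r\<close>. The law \<open>x + x = 0\<close> is required on the whole type, so that computations with sums need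
  no membership conditions.\<close>

locale boolean_duality =
  fixes V :: "'a::ab_group_add set" and chr :: "'a \<Rightarrow> 'a \<Rightarrow> real"
  assumes finite_V: "finite V"
    and zero_V [simp]: "0 \<in> V"
    and add_V [simp]: "x \<in> V \<Longrightarrow> y \<in> V \<Longrightarrow> x + y \<in> V"
    and add_self [simp]: "x + x = (0::'a)"
    and chr_cases: "chr r x = 1 \<or> chr r x = - 1"
    and chr_add: "chr r (x + y) = chr r x * chr r y"
    and chr_sym: "chr r x = chr x r"
    and chr_nondegenerate: "x \<in> V \<Longrightarrow> x \<noteq> 0 \<Longrightarrow> \<exists>r\<in>V. chr r x = - 1"
begin

lemma add_self_left [simp]: "x + (x + y) = (y::'a)"
  by (simp flip: add.assoc)

lemma add_eq_0_iff_eq [simp]: "x + y = 0 \<longleftrightarrow> x = (y::'a)"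
  by (metis add_self add_self_left add_0_right)

lemma add_eq_iff: "x + y = z \<longleftrightarrow> x = y + (z::'a)"
  by (metis add.commute add_self_left)

lemma chr_square [simp]: "chr r x * chr r x = 1"
  using chr_cases[of r x] by auto

lemma abs_chr [simp]: "\<bar>chr r x\<bar> = 1"
  using chr_cases[of r x] by auto

lemma chr_zero_right [simp]: "chr r 0 = 1"
  using chr_add[of r 0 0] chr_cases[of r 0] by auto

lemma chr_zero_left [simp]: "chr 0 x = 1"
  by (subst chr_sym) simp

lemma chr_add_left: "chr (r + t) x = chr r x * chr t x"
  using chr_add chr_sym by metis

lemma neq_1_iff [simp]: "chr r x \<noteq> 1 \<longleftrightarrow> chr r x = - 1" "chr r x \<noteq> - 1 \<longleftrightarrow> chr r x = 1"
  using chr_cases[of r x] by auto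

lemma card_V_pos: "0 < card V"
  using finite_V zero_V card_gt_0_iff by blast

lemma sum_translate:
  assumes "a \<in> V"
  shows "(\<Sum>x\<in>V. f (x + a)) = (\<Sum>x\<in>V. f x)"
  by (rule sum.reindex_bij_witness[of _ "\<lambda>x. x + a" "\<lambda>x. x + a"]) (use assms in \<open>auto simp: add.assoc\<close>)

text \<open>Translating by an element where a nontrivial character is \<open>-1\<close> negates its sum.\<close>

lemma sum_chr:
  assumes "r \<in> V"
  shows "(\<Sum>x\<in>V. chr r x) = (if r = 0 then real (card V) else 0)"
proof (cases "r = 0")
  case False
  then obtain a where a: "a \<in> V" "chr r a = - 1"
    using chr_nondegenerate[OF assms] chr_sym by metis
  have "(\<Sum>x\<in>V. chr r (x + a)) = - (\<Sum>x\<in>V. chr r x)"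
    by (simp add: chr_add a sum_negf)
  then show ?thesis using sum_translate[OF a(1), of "chr r"] False by simp
qed simp

lemma sum_chr_dual: "x \<in> V \<Longrightarrow> (\<Sum>r\<in>V. chr r x) = (if x = 0 then real (card V) else 0)"
  using sum_chr[of x] by (simp add: chr_sym[of _ x])

definition fourier :: "('a \<Rightarrow> real) \<Rightarrow> 'a \<Rightarrow> real" where
  "fourier f r = (\<Sum>x\<in>V. f x * chr r x)"

lemma parseval: "(\<Sum>r\<in>V. (fourier f r)\<^sup>2) = real (card V) * (\<Sum>x\<in>V. (f x)\<^sup>2)"
proof -
  have "(\<Sum>r\<in>V. (fourier f r)\<^sup>2) = (\<Sum>r\<in>V. \<Sum>x\<in>V. \<Sum>y\<in>V. f x * f y * chr r (x + y))"
    by (simp add: fourier_def power2_eq_square sum_product chr_add mult_ac)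
  also have "\<dots> = (\<Sum>x\<in>V. \<Sum>r\<in>V. \<Sum>y\<in>V. f x * f y * chr r (x + y))" by (rule sum.swap)
  also have "\<dots> = (\<Sum>x\<in>V. \<Sum>y\<in>V. \<Sum>r\<in>V. f x * f y * chr r (x + y))"
    by (rule sum.cong[OF refl], rule sum.swap)
  also have "\<dots> = (\<Sum>x\<in>V. \<Sum>y\<in>V. f x * f y * (if x = y then real (card V) else 0))"
    by (intro sum.cong refl) (simp flip: sum_distrib_left add: sum_chr_dual)
  also have "\<dots> = (\<Sum>x\<in>V. f x * f x * real (card V))"
    by (intro sum.cong refl) (simp add: if_distrib[of "\<lambda>c. _ * c"] finite_V cong: if_cong)
  finally show ?thesis by (simp add: sum_distrib_left power2_eq_square mult_ac)
qed

text \<open>In characteristic 2 the equation \<open>x = y + z\<close> is the symmetric condition \<open>x + y + z = 0\<close>, which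
  orthogonality of characters detects.\<close>

lemma sum_fourier_triple:
  "(\<Sum>r\<in>V. fourier f r * fourier g r * fourier h r) = real (card V) * (\<Sum>y\<in>V. \<Sum>z\<in>V. f (y + z) * g y * h z)"
proof -
  have "fourier f r * fourier g r * fourier h r
      = (\<Sum>y\<in>V. \<Sum>z\<in>V. \<Sum>x\<in>V. f x * g y * h z * chr r (x + (y + z)))" for r
  proof -
    have "fourier f r * fourier g r * fourier h r = fourier g r * (fourier h r * fourier f r)" by (simp add: mult_ac)
    also have "fourier h r * fourier f r = (\<Sum>z\<in>V. \<Sum>x\<in>V. h z * chr r z * (f x * chr r x))"
      unfolding fourier_def by (rule sum_product)
    also have "fourier g r * \<dots> = (\<Sum>y\<in>V. \<Sum>z\<in>V. g y * chr r y * (\<Sum>x\<in>V. h z * chr r z * (f x * chr r x)))"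
      unfolding fourier_def by (rule sum_product)
    finally show ?thesis by (simp add: sum_distrib_left chr_add mult_ac)
  qed
  then have "(\<Sum>r\<in>V. fourier f r * fourier g r * fourier h r)
      = (\<Sum>r\<in>V. \<Sum>y\<in>V. \<Sum>z\<in>V. \<Sum>x\<in>V. f x * g y * h z * chr r (x + (y + z)))"
    by simp
  also have "\<dots> = (\<Sum>y\<in>V. \<Sum>r\<in>V. \<Sum>z\<in>V. \<Sum>x\<in>V. f x * g y * h z * chr r (x + (y + z)))"
    by (rule sum.swap)
  also have "\<dots> = (\<Sum>y\<in>V. \<Sum>z\<in>V. \<Sum>r\<in>V. \<Sum>x\<in>V. f x * g y * h z * chr r (x + (y + z)))"
    by (rule sum.cong[OF refl], rule sum.swap)
  also have "\<dots> = (\<Sum>y\<in>V. \<Sum>z\<in>V. \<Sum>x\<in>V. \<Sum>r\<in>V. f x * g y * h z * chr r (x + (y + z)))"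
    by (rule sum.cong[OF refl], rule sum.cong[OF refl], rule sum.swap)
  also have "\<dots> = (\<Sum>y\<in>V. \<Sum>z\<in>V. \<Sum>x\<in>V. f x * g y * h z * (if x = y + z then real (card V) else 0))"
    by (intro sum.cong refl) (simp flip: sum_distrib_left add: sum_chr_dual)
  also have "\<dots> = (\<Sum>y\<in>V. \<Sum>z\<in>V. f (y + z) * g y * h z * real (card V))"
    by (intro sum.cong refl) (simp add: if_distrib[of "\<lambda>c. _ * c"] finite_V cong: if_cong)
  finally show ?thesis by (simp add: sum_distrib_left mult_ac)
qed

definition odd_part :: "'a \<Rightarrow> 'a set" where
  "odd_part r = {x \<in> V. chr r x = - 1}"

definition even_part :: "'a \<Rightarrow> 'a set" where
  "even_part r = {x \<in> V. chr r x = 1}"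

lemma finite_parts [simp]: "finite (odd_part r)" "finite (even_part r)"
  using finite_V by (auto simp: odd_part_def even_part_def)

lemma parts_partition: "odd_part r \<union> even_part r = V" "odd_part r \<inter> even_part r = {}"
  using chr_cases[of r] by (auto simp: odd_part_def even_part_def)

lemma odd_part_subset: "odd_part r \<subseteq> V"
  by (auto simp: odd_part_def)

lemma card_eq_sum: "A \<subseteq> V \<Longrightarrow> real (card A) = (\<Sum>x\<in>V. of_bool (x \<in> A))"
  using finite_V by (simp add: Int_absorb1 flip: of_nat_sum)

lemma card_odd_part:
  assumes "r \<in> V" "r \<noteq> 0"
  shows "2 * card (odd_part r) = card V"
proof -
  have "real (card (odd_part r)) = (\<Sum>x\<in>V. of_bool (x \<in> odd_part r))"
    by (rule card_eq_sum) (auto simp: odd_part_def)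
  also have "\<dots> = (\<Sum>x\<in>V. (1 - chr r x) / 2)"
    by (rule sum.cong) (use chr_cases[of r] in \<open>auto simp: odd_part_def\<close>)
  also have "\<dots> = real (card V) / 2"
    using sum_chr[OF assms(1)] assms(2) by (simp add: sum_subtractf flip: sum_divide_distrib)
  finally show ?thesis by linarith
qed

lemma card_even_part:
  assumes "r \<in> V" "r \<noteq> 0"
  shows "2 * card (even_part r) = card V"
  using card_odd_part[OF assms] parts_partition[of r] card_Un_disjoint[of "odd_part r" "even_part r"]
  by simp

lemma card_odd_part_Int:
  assumes "r \<in> V" "r \<noteq> 0" "t \<in> V" "t \<noteq> 0" "r \<noteq> t"
  shows "4 * card (odd_part r \<inter> odd_part t) = card V"
proof -
  have "real (card (odd_part r \<inter> odd_part t)) = (\<Sum>x\<in>V. of_bool (x \<in> odd_part r \<inter> odd_part t))"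
    by (rule card_eq_sum) (auto simp: odd_part_def)
  also have "\<dots> = (\<Sum>x\<in>V. (1 - chr r x - chr t x + chr (r + t) x) / 4)"
    by (rule sum.cong)
      (use chr_cases[of r] chr_cases[of t] in \<open>auto simp: odd_part_def chr_add_left\<close>)
  also have "\<dots> = real (card V) / 4"
    using sum_chr[of r] sum_chr[of t] sum_chr[of "r + t"] assms
    by (simp add: sum_subtractf sum.distrib flip: sum_divide_distrib)
  finally show ?thesis by linarith
qed

definition sumfree :: "'a set \<Rightarrow> bool" where
  "sumfree A \<longleftrightarrow> A \<subseteq> V \<and> (\<forall>x\<in>A. \<forall>y\<in>A. x + y \<notin> A)"

lemma sumfree_subset: "sumfree A \<Longrightarrow> B \<subseteq> A \<Longrightarrow> sumfree B"
  unfolding sumfree_def by blast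

lemma sumfree_finite: "sumfree A \<Longrightarrow> finite A"
  unfolding sumfree_def using finite_V finite_subset by blast

lemma sumfree_zero: "sumfree A \<Longrightarrow> 0 \<notin> A"
  unfolding sumfree_def by (metis add_self)

lemma sumfree_odd_part: "sumfree (odd_part r)"
  unfolding sumfree_def odd_part_def by (auto simp: chr_add)

text \<open>Translation by \<open>e\<close> pairs up the odd part, and a sum-free set containing \<open>e\<close> has at most one
  element of each pair.\<close>

lemma card_sumfree_odd_le:
  assumes "sumfree B" "e \<in> B" "chr r e = 1" "r \<in> V" "r \<noteq> 0"
  shows "4 * card (B \<inter> odd_part r) \<le> card V"
proof -
  let ?I = "B \<inter> odd_part r" and ?J = "(\<lambda>x. x + e) ` (B \<inter> odd_part r)"
  have "card ?J = card ?I" by (rule card_image) (auto simp: inj_on_def)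
  moreover have "?I \<inter> ?J = {}" using assms(1,2) unfolding sumfree_def by auto
  moreover have "?I \<union> ?J \<subseteq> odd_part r"
    using assms(1-3) by (auto simp: odd_part_def chr_add sumfree_def)
  ultimately have "2 * card ?I \<le> card (odd_part r)"
    using card_Un_disjoint[of ?I ?J] card_mono[of "odd_part r" "?I \<union> ?J"] by simp
  then show ?thesis using card_odd_part[OF assms(4,5)] by linarith
qed

text \<open>Let \<open>f\<close> be the indicator of \<open>B\<close>. Its cubed Fourier coefficients sum to zero because \<open>B\<close> has no
  Schur triple, although the coefficient at 0 is \<open>card B\<close>; so some other coefficient is very negative.
  If \<open>B\<close> met the even part of every nonzero index, \<open>card_sumfree_odd_le\<close> would keep all other coefficients at
  least \<open>card B - card V / 2\<close>, and Parseval's identity would then force \<open>3 * card B \<le> card V\<close>.\<close>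

theorem sumfree_large_subset_odd_part:
  assumes "sumfree B" "card V < 3 * card B"
  shows "\<exists>r\<in>V. r \<noteq> 0 \<and> B \<subseteq> odd_part r"
proof (rule ccontr)
  assume neg: "\<not> ?thesis"
  define f :: "'a \<Rightarrow> real" where "f x = of_bool (x \<in> B)" for x
  let ?n = "real (card V)" and ?b = "real (card B)"
  have BV: "B \<subseteq> V" using assms(1) by (simp add: sumfree_def)
  have f_sum: "(\<Sum>x\<in>V. f x) = ?b" using card_eq_sum[OF BV] by (simp add: f_def)
  have f_sq: "(f x)\<^sup>2 = f x" for x by (simp add: f_def)
  have ft0: "fourier f 0 = ?b" by (simp add: fourier_def f_sum)
  have "(\<Sum>r\<in>V. fourier f r * fourier f r * fourier f r) = 0"
    unfolding sum_fourier_triple using assms(1) by (auto simp: f_def sumfree_def intro!: sum.neutral)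
  then have cubes: "?b ^ 3 + (\<Sum>r\<in>V - {0}. fourier f r ^ 3) = 0"
    using sum.remove[OF finite_V zero_V, of "\<lambda>r. fourier f r ^ 3"] ft0
    by (simp add: power3_eq_cube)
  have "(\<Sum>r\<in>V. (fourier f r)\<^sup>2) = ?n * ?b" using parseval[of f] by (simp add: f_sq f_sum)
  then have squares: "(\<Sum>r\<in>V - {0}. (fourier f r)\<^sup>2) = ?n * ?b - ?b ^ 2"
    using sum.remove[OF finite_V zero_V, of "\<lambda>r. (fourier f r)\<^sup>2"] ft0 by simp
  have lower: "?b - ?n / 2 \<le> fourier f r" if r: "r \<in> V - {0}" for r
  proof -
    obtain e where "e \<in> B" "chr r e = 1"
      using neg r BV neq_1_iff(2) unfolding odd_part_def by blast
    then have "4 * card (B \<inter> odd_part r) \<le> card V"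
      using card_sumfree_odd_le[OF assms(1)] r by blast
    moreover have "fourier f r = ?b - 2 * real (card (B \<inter> odd_part r))"
    proof -
      have "fourier f r = (\<Sum>x\<in>V. f x - 2 * of_bool (x \<in> B \<inter> odd_part r))"
        unfolding fourier_def by (rule sum.cong) (use chr_cases[of r] in \<open>auto simp: f_def odd_part_def\<close>)
      also have "\<dots> = ?b - 2 * real (card (B \<inter> odd_part r))"
        using card_eq_sum[of "B \<inter> odd_part r"] BV f_sum
        by (simp add: sum_subtractf sum_distrib_left le_infI1)
      finally show ?thesis .
    qed
    ultimately show ?thesis by linarith
  qed
  have "(\<Sum>r\<in>V - {0}. (?b - ?n / 2) * (fourier f r)\<^sup>2) \<le> (\<Sum>r\<in>V - {0}. fourier f r ^ 3)"
  proof (rule sum_mono)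
    fix r assume "r \<in> V - {0}"
    from mult_right_mono[OF lower[OF this], of "(fourier f r)\<^sup>2"]
    show "(?b - ?n / 2) * (fourier f r)\<^sup>2 \<le> fourier f r ^ 3" by (simp add: power2_eq_square power3_eq_cube mult_ac)
  qed
  then have "?b ^ 3 + (?b - ?n / 2) * (?n * ?b - ?b ^ 2) \<le> 0"
    using cubes by (simp flip: sum_distrib_left add: squares)
  then have "?n * ?b * (3 * ?b - ?n) \<le> 0" by (simp add: power2_eq_square power3_eq_cube algebra_simps)
  moreover have "0 < ?n * ?b * (3 * ?b - ?n)" using assms(2) card_V_pos by simp
  ultimately show False by linarith
qed

end

section \<open>An arithmetic regularity lemma\<close>

text \<open>The number of characters after \<open>j\<close> refinements, when each of the at most \<open>2^K\<close> atoms of \<open>K\<close>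
  characters may contribute one new character.\<close>

primrec tower_bound :: "nat \<Rightarrow> nat" where
  "tower_bound 0 = 0"
| "tower_bound (Suc j) = tower_bound j + 2 ^ tower_bound j"

context boolean_duality
begin

text \<open>The cosets of the common kernel of the characters in \<open>R\<close>.\<close>

definition atom :: "'a set \<Rightarrow> 'a \<Rightarrow> 'a set" where
  "atom R x = {y \<in> V. \<forall>r\<in>R. chr r y = chr r x}"

text \<open>All atoms have the size of the atom of 0 (\<open>card_atom\<close>), which therefore serves as the
  denominator.\<close>

definition density :: "'a set \<Rightarrow> 'a set \<Rightarrow> 'a \<Rightarrow> real" where
  "density A R x = real (card (A \<inter> atom R x)) / real (card (atom R 0))"

lemma finite_atom [simp]: "finite (atom R x)"
  using finite_V by (simp add: atom_def)

lemma atom_subset: "atom R x \<subseteq> V"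
  by (auto simp: atom_def)

lemma mem_atom_self [simp]: "x \<in> V \<Longrightarrow> x \<in> atom R x"
  by (simp add: atom_def)

lemma mem_atom_commute: "x \<in> V \<Longrightarrow> y \<in> V \<Longrightarrow> y \<in> atom R x \<longleftrightarrow> x \<in> atom R y"
  by (auto simp: atom_def)

lemma atom_eq: "y \<in> atom R x \<Longrightarrow> atom R y = atom R x"
  by (auto simp: atom_def)

lemma density_eq: "y \<in> atom R x \<Longrightarrow> density A R y = density A R x"
  unfolding density_def by (drule atom_eq) simp

lemma card_atom:
  assumes x: "x \<in> V"
  shows "card (atom R x) = card (atom R 0)"
proof -
  have "(\<lambda>y. y + x) ` atom R 0 = atom R x"
  proof
    show "(\<lambda>y. y + x) ` atom R 0 \<subseteq> atom R x"
      unfolding atom_def by (clarify, intro CollectI conjI ballI) (use x in \<open>simp_all add: chr_add\<close>)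
    show "atom R x \<subseteq> (\<lambda>y. y + x) ` atom R 0"
    proof
      fix y assume y: "y \<in> atom R x"
      have "y + x \<in> atom R 0" using x y unfolding atom_def by (simp add: chr_add)
      moreover have "y = (y + x) + x" by (simp add: add.assoc)
      ultimately show "y \<in> (\<lambda>y. y + x) ` atom R 0" by blast
    qed
  qed
  then show ?thesis using card_image[of "\<lambda>y. y + x" "atom R 0"] by (simp add: inj_on_def)
qed

lemma card_atom_pos: "0 < card (atom R 0)"
  using mem_atom_self[OF zero_V, of R] by (auto simp: card_gt_0_iff simp del: mem_atom_self)

lemma density_nonneg: "0 \<le> density A R x"
  by (simp add: density_def)

lemma card_Int_atom_le: "x \<in> V \<Longrightarrow> card (A \<inter> atom R x) \<le> card (atom R 0)"
  using card_mono[of "atom R x" "A \<inter> atom R x"] card_atom[of x R] by simp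

lemma density_le_1: "x \<in> V \<Longrightarrow> density A R x \<le> 1"
  using card_Int_atom_le[of x A R] card_atom_pos[of R] by (simp add: density_def)

text \<open>The function \<open>density A R\<close> is the conditional expectation of the indicator of \<open>A\<close> on the partition
  into atoms, so it may replace the indicator against functions constant on atoms.\<close>

lemma sum_mult_density:
  assumes "A \<subseteq> V" and const: "\<And>x y. x \<in> V \<Longrightarrow> y \<in> atom R x \<Longrightarrow> f y = f x"
  shows "(\<Sum>x\<in>V. f x * density A R x) = (\<Sum>x\<in>V. f x * of_bool (x \<in> A))"
proof -
  let ?h = "real (card (atom R 0))"
  have d: "density A R x = (\<Sum>y\<in>V. of_bool (y \<in> A) * of_bool (y \<in> atom R x) / ?h)" for x
  proof -
    have "real (card (A \<inter> atom R x)) = (\<Sum>y\<in>V. of_bool (y \<in> A \<inter> atom R x))"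
      using assms(1) by (intro card_eq_sum) auto
    then show ?thesis by (simp add: density_def sum_divide_distrib of_bool_conj)
  qed
  have "(\<Sum>x\<in>V. f x * density A R x)
      = (\<Sum>x\<in>V. \<Sum>y\<in>V. f x * (of_bool (y \<in> A) * of_bool (y \<in> atom R x) / ?h))"
    by (simp add: d sum_distrib_left)
  also have "\<dots> = (\<Sum>y\<in>V. \<Sum>x\<in>V. f x * (of_bool (y \<in> A) * of_bool (y \<in> atom R x) / ?h))"
    by (rule sum.swap)
  also have "\<dots> = (\<Sum>y\<in>V. f y * of_bool (y \<in> A))"
  proof (rule sum.cong[OF refl])
    fix y assume y: "y \<in> V"
    have "(\<Sum>x\<in>V. f x * (of_bool (y \<in> A) * of_bool (y \<in> atom R x) / ?h))
        = (\<Sum>x\<in>V. f y * of_bool (y \<in> A) / ?h * of_bool (x \<in> atom R y))"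
    proof (rule sum.cong[OF refl])
      fix x assume x: "x \<in> V"
      show "f x * (of_bool (y \<in> A) * of_bool (y \<in> atom R x) / ?h)
          = f y * of_bool (y \<in> A) / ?h * of_bool (x \<in> atom R y)"
      proof (cases "x \<in> atom R y")
        case True
        then show ?thesis using const[OF y True] mem_atom_commute[OF y x, of R] by simp
      next
        case False
        then show ?thesis using mem_atom_commute[OF y x, of R] by simp
      qed
    qed
    also have "\<dots> = f y * of_bool (y \<in> A) / ?h * real (card (atom R y))"
      by (simp add: card_eq_sum[OF atom_subset] sum_distrib_left)
    also have "\<dots> = f y * of_bool (y \<in> A)"
      using card_atom[OF y, of R] card_atom_pos[of R] by (simp add: card_gt_0_iff)
    finally show "(\<Sum>x\<in>V. f x * (of_bool (y \<in> A) * of_bool (y \<in> atom R x) / ?h)) = f y * of_bool (y \<in> A)" .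
  qed
  finally show ?thesis .
qed

definition deviation :: "'a set \<Rightarrow> 'a set \<Rightarrow> 'a \<Rightarrow> 'a \<Rightarrow> real" where
  "deviation A R x y = of_bool (y \<in> atom R x) * (of_bool (y \<in> A) - density A R x)"

text \<open>A regular atom is one on which the centred indicator of \<open>A\<close> correlates with no character by
  more than the fraction \<open>\<eta>\<close> of its size.\<close>

definition irregular :: "'a set \<Rightarrow> 'a set \<Rightarrow> real \<Rightarrow> 'a set" where
  "irregular A R \<eta> = {x \<in> V. \<exists>r\<in>V. \<eta> * real (card (atom R 0)) < \<bar>fourier (deviation A R x) r\<bar>}"

lemma deviation_eq: "y \<in> atom R x \<Longrightarrow> deviation A R y = deviation A R x"
  unfolding deviation_def by (simp only: density_eq[of y R x] atom_eq[of y R x])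

lemma irregular_subset: "irregular A R \<eta> \<subseteq> V"
  by (auto simp: irregular_def)

lemma irregular_cong: "x \<in> V \<Longrightarrow> y \<in> atom R x \<Longrightarrow> y \<in> irregular A R \<eta> \<longleftrightarrow> x \<in> irregular A R \<eta>"
  using atom_subset[of R x] unfolding irregular_def by (auto simp only: deviation_eq[of y R x] mem_Collect_eq)

definition energy :: "'a set \<Rightarrow> 'a set \<Rightarrow> real" where
  "energy A R = (\<Sum>x\<in>V. (density A R x)\<^sup>2)"

lemma energy_nonneg: "0 \<le> energy A R"
  by (simp add: energy_def sum_nonneg)

lemma energy_le: "energy A R \<le> real (card V)"
proof -
  have "energy A R \<le> (\<Sum>x\<in>V. 1)"
    unfolding energy_def
    by (rule sum_mono) (use density_le_1 density_nonneg in \<open>simp add: power_le_one\<close>)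
  then show ?thesis by simp
qed

lemma card_atoms_le:
  assumes "finite R"
  shows "card (atom R ` X) \<le> 2 ^ card R"
proof -
  have "atom R ` X \<subseteq> (\<lambda>P. {y \<in> V. \<forall>r\<in>R. chr r y = 1 \<longleftrightarrow> r \<in> P}) ` Pow R"
  proof (rule image_subsetI)
    fix x assume "x \<in> X"
    have "atom R x = {y \<in> V. \<forall>r\<in>R. chr r y = 1 \<longleftrightarrow> r \<in> {r \<in> R. chr r x = 1}}"
      using chr_cases by (fastforce simp: atom_def)
    then show "atom R x \<in> (\<lambda>P. {y \<in> V. \<forall>r\<in>R. chr r y = 1 \<longleftrightarrow> r \<in> P}) ` Pow R" by blast
  qed
  then have "card (atom R ` X) \<le> card (Pow R)" using assms by (intro surj_card_le) auto
  then show ?thesis by (simp add: card_Pow assms)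
qed

text \<open>Pythagoras for conditional expectations on nested partitions.\<close>

lemma energy_refine:
  assumes "A \<subseteq> V" "R \<subseteq> R'"
  shows "energy A R' = energy A R + (\<Sum>x\<in>V. (density A R' x - density A R x)\<^sup>2)"
proof -
  have sub: "atom R' x \<subseteq> atom R x" for x using assms(2) by (auto simp: atom_def)
  have "(\<Sum>x\<in>V. density A R x * density A R' x) = (\<Sum>x\<in>V. density A R x * of_bool (x \<in> A))"
    using assms(1) by (rule sum_mult_density) (use sub density_eq in blast)
  also have "\<dots> = (\<Sum>x\<in>V. density A R x * density A R x)"
    using assms(1) by (rule sum_mult_density[symmetric]) (rule density_eq)
  finally have "(\<Sum>x\<in>V. density A R x * density A R' x) = energy A R"
    by (simp add: energy_def power2_eq_square)
  then show ?thesis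
    by (simp add: energy_def power2_diff sum.distrib sum_subtractf mult.commute mult.left_commute
        flip: sum_distrib_left)
qed

text \<open>For every irregular atom add a character witnessing the irregularity to \<open>R\<close>. This character is
  constant on the new atoms, so the correlation survives averaging over them, and the inequality of
  Cauchy and Schwarz turns it into an increase of energy on that atom.\<close>

lemma energy_increment:
  assumes A: "A \<subseteq> V" and R: "R \<subseteq> V" and \<eta>: "0 \<le> \<eta>"
  shows "\<exists>R'. R \<subseteq> R' \<and> R' \<subseteq> V \<and> card R' \<le> card R + 2 ^ card R
    \<and> energy A R + \<eta>\<^sup>2 * real (card (irregular A R \<eta>)) \<le> energy A R'"
proof -
  let ?h = "real (card (atom R 0))" and ?Irr = "irregular A R \<eta>"
  have finR: "finite R" using R finite_V finite_subset by blast
  define dev where "dev a y = of_bool (y \<in> a) * (of_bool (y \<in> A) - real (card (A \<inter> a)) / ?h)" for a y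
  \<comment> \<open>The witness depends on the atom and not on the chosen point of it, so that the number of
    new characters is at most the number of atoms.\<close>
  define wit where "wit a = (SOME r. r \<in> V \<and> \<eta> * ?h < \<bar>fourier (dev a) r\<bar>)" for a
  have dev: "deviation A R x = dev (atom R x)" for x
    by (simp add: fun_eq_iff deviation_def dev_def density_def)
  have wit: "wit (atom R x) \<in> V \<and> \<eta> * ?h < \<bar>fourier (deviation A R x) (wit (atom R x))\<bar>"
    if "x \<in> ?Irr" for x
    unfolding dev wit_def by (rule someI_ex) (use that in \<open>auto simp: irregular_def dev\<close>)
  define R' where "R' = R \<union> wit ` atom R ` ?Irr"
  have "card R' \<le> card R + card (wit ` atom R ` ?Irr)" unfolding R'_def by (rule card_Un_le)
  also have "card (wit ` atom R ` ?Irr) \<le> card (atom R ` ?Irr)"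
    by (rule card_image_le) (rule finite_imageI, rule finite_subset[OF irregular_subset finite_V])
  also have "\<dots> \<le> 2 ^ card R" by (rule card_atoms_le[OF finR])
  finally have cR': "card R' \<le> card R + 2 ^ card R" by simp
  have sub: "atom R' x \<subseteq> atom R x" for x by (auto simp: atom_def R'_def)
  define D where "D y = density A R' y - density A R y" for y
  have local: "\<eta>\<^sup>2 * ?h \<le> (\<Sum>y\<in>V. of_bool (y \<in> atom R x) * (D y)\<^sup>2)" if x: "x \<in> ?Irr" for x
  proof -
    define r where "r = wit (atom R x)"
    have xV: "x \<in> V" using x irregular_subset by blast
    have rR': "r \<in> R'" using x by (auto simp: R'_def r_def)
    let ?f = "\<lambda>y. of_bool (y \<in> atom R x) * chr r y"
    have "fourier (deviation A R x) r
        = (\<Sum>y\<in>V. ?f y * of_bool (y \<in> A)) - (\<Sum>y\<in>V. ?f y * density A R y)"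
      unfolding fourier_def sum_subtractf[symmetric]
      by (rule sum.cong) (auto simp: deviation_def density_eq[of _ R x] algebra_simps)
    also have "(\<Sum>y\<in>V. ?f y * of_bool (y \<in> A)) = (\<Sum>y\<in>V. ?f y * density A R' y)"
    proof (rule sum_mult_density[symmetric, OF A])
      fix u v assume u: "u \<in> V" and "v \<in> atom R' u"
      then have "v \<in> atom R u" "chr r v = chr r u" using sub rR' by (auto simp: atom_def)
      then show "?f v = ?f u" using u by (auto simp: atom_def)
    qed
    also have "(\<Sum>y\<in>V. ?f y * density A R' y) - (\<Sum>y\<in>V. ?f y * density A R y)
        = (\<Sum>y\<in>V. ?f y * (of_bool (y \<in> atom R x) * D y))"
      unfolding sum_subtractf[symmetric] by (rule sum.cong) (auto simp: D_def algebra_simps)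
    finally have ftD: "fourier (deviation A R x) r = (\<Sum>y\<in>V. ?f y * (of_bool (y \<in> atom R x) * D y))" .
    have "(\<Sum>y\<in>V. ?f y * (of_bool (y \<in> atom R x) * D y))\<^sup>2
        \<le> (\<Sum>y\<in>V. (?f y)\<^sup>2) * (\<Sum>y\<in>V. (of_bool (y \<in> atom R x) * D y)\<^sup>2)"
      by (rule Cauchy_Schwarz_ineq_sum)
    also have "(\<Sum>y\<in>V. (?f y)\<^sup>2) = (\<Sum>y\<in>V. of_bool (y \<in> atom R x))"
      by (rule sum.cong) (simp_all add: power_mult_distrib power2_eq_square)
    also have "\<dots> = ?h" using card_eq_sum[OF atom_subset] card_atom[OF xV] by metis
    also have "(\<Sum>y\<in>V. (of_bool (y \<in> atom R x) * D y)\<^sup>2) = (\<Sum>y\<in>V. of_bool (y \<in> atom R x) * (D y)\<^sup>2)"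
      by (rule sum.cong) (simp_all add: power_mult_distrib power2_eq_square)
    finally have CS: "(fourier (deviation A R x) r)\<^sup>2 \<le> ?h * (\<Sum>y\<in>V. of_bool (y \<in> atom R x) * (D y)\<^sup>2)"
      by (simp only: ftD)
    have "\<eta> * ?h \<le> \<bar>fourier (deviation A R x) r\<bar>" using wit[OF x] by (simp add: r_def)
    then have "(\<eta> * ?h)\<^sup>2 \<le> (fourier (deviation A R x) r)\<^sup>2"
      using \<eta> by (metis abs_ge_zero abs_le_square_iff abs_of_nonneg mult_nonneg_nonneg of_nat_0_le_iff)
    with CS have "?h * (\<eta>\<^sup>2 * ?h) \<le> ?h * (\<Sum>y\<in>V. of_bool (y \<in> atom R x) * (D y)\<^sup>2)"
      by (simp add: power_mult_distrib power2_eq_square mult_ac)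
    then show ?thesis using card_atom_pos[of R] by (simp add: mult_le_cancel_left)
  qed
  have "real (card ?Irr) * (\<eta>\<^sup>2 * ?h) = (\<Sum>x\<in>?Irr. \<eta>\<^sup>2 * ?h)" by simp
  also have "\<dots> \<le> (\<Sum>x\<in>?Irr. \<Sum>y\<in>V. of_bool (y \<in> atom R x) * (D y)\<^sup>2)"
    by (rule sum_mono) (rule local)
  also have "\<dots> \<le> (\<Sum>x\<in>V. \<Sum>y\<in>V. of_bool (y \<in> atom R x) * (D y)\<^sup>2)"
    by (rule sum_mono2) (use finite_V irregular_subset in \<open>auto intro: sum_nonneg\<close>)
  also have "\<dots> = (\<Sum>y\<in>V. \<Sum>x\<in>V. of_bool (y \<in> atom R x) * (D y)\<^sup>2)" by (rule sum.swap)
  also have "\<dots> = (\<Sum>y\<in>V. ?h * (D y)\<^sup>2)"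
  proof (rule sum.cong[OF refl])
    fix y assume y: "y \<in> V"
    have "(\<Sum>x\<in>V. of_bool (y \<in> atom R x) * (D y)\<^sup>2) = (\<Sum>x\<in>V. of_bool (x \<in> atom R y)) * (D y)\<^sup>2"
      unfolding sum_distrib_right by (rule sum.cong) (use y mem_atom_commute in auto)
    also have "(\<Sum>x\<in>V. of_bool (x \<in> atom R y)) = ?h"
      using card_eq_sum[OF atom_subset] card_atom[OF y] by metis
    finally show "(\<Sum>x\<in>V. of_bool (y \<in> atom R x) * (D y)\<^sup>2) = ?h * (D y)\<^sup>2" .
  qed
  also have "\<dots> = ?h * (\<Sum>y\<in>V. (D y)\<^sup>2)" by (simp add: sum_distrib_left)
  finally have "?h * (\<eta>\<^sup>2 * real (card ?Irr)) \<le> ?h * (\<Sum>y\<in>V. (D y)\<^sup>2)" by (simp add: mult_ac)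
  then have "\<eta>\<^sup>2 * real (card ?Irr) \<le> (\<Sum>y\<in>V. (D y)\<^sup>2)"
    using card_atom_pos[of R] by (simp add: mult_le_cancel_left)
  moreover have "energy A R' = energy A R + (\<Sum>y\<in>V. (D y)\<^sup>2)"
    unfolding D_def by (rule energy_refine[OF A]) (auto simp: R'_def)
  moreover have "R' \<subseteq> V" using R wit by (auto simp: R'_def)
  ultimately show ?thesis using cR' by (intro exI[of _ R']) (auto simp: R'_def)
qed

text \<open>The energy stays below \<open>card V\<close>, and each refinement of an irregular partition raises it by at
  least \<open>\<eta>\<^sup>2 * \<epsilon> * card V\<close>; hence a regular partition appears within \<open>J\<close> steps, whatever the size
  of \<open>V\<close>.\<close>

theorem arithmetic_regularity:
  assumes A: "A \<subseteq> V" and "0 < \<epsilon>" "0 < \<eta>" and J: "1 < real J * (\<eta>\<^sup>2 * \<epsilon>)"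
  shows "\<exists>R\<subseteq>V. card R \<le> tower_bound J \<and> real (card (irregular A R \<eta>)) \<le> \<epsilon> * real (card V)"
proof -
  let ?n = "real (card V)"
  have "\<exists>R\<subseteq>V. card R \<le> tower_bound j \<and>
      (real (card (irregular A R \<eta>)) \<le> \<epsilon> * ?n \<or> real j * (\<eta>\<^sup>2 * \<epsilon>) * ?n \<le> energy A R)" for j
  proof (induction j)
    case 0
    show ?case by (intro exI[of _ "{}"]) (simp add: energy_nonneg)
  next
    case (Suc j)
    then obtain R where R: "R \<subseteq> V" "card R \<le> tower_bound j"
      and alt: "real (card (irregular A R \<eta>)) \<le> \<epsilon> * ?n \<or> real j * (\<eta>\<^sup>2 * \<epsilon>) * ?n \<le> energy A R"
      by blast
    show ?case
    proof (cases "real (card (irregular A R \<eta>)) \<le> \<epsilon> * ?n")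
      case True
      then show ?thesis using R by (intro exI[of _ R]) auto
    next
      case False
      obtain R' where R': "R' \<subseteq> V" "card R' \<le> card R + 2 ^ card R"
        "energy A R + \<eta>\<^sup>2 * real (card (irregular A R \<eta>)) \<le> energy A R'"
        using energy_increment[OF A R(1), of \<eta>] assms(3) by auto
      have "\<eta>\<^sup>2 * (\<epsilon> * ?n) \<le> \<eta>\<^sup>2 * real (card (irregular A R \<eta>))"
        using False by (intro mult_left_mono) auto
      then have "real (Suc j) * (\<eta>\<^sup>2 * \<epsilon>) * ?n \<le> energy A R'"
        using alt False R'(3) by (simp add: algebra_simps)
      moreover have "card R' \<le> tower_bound (Suc j)"
      proof -
        have "(2::nat) ^ card R \<le> 2 ^ tower_bound j" using R(2) by (intro power_increasing) auto
        then show ?thesis using R'(2) R(2) unfolding tower_bound.simps by linarith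
      qed
      ultimately show ?thesis using R'(1) by blast
    qed
  qed
  then obtain R where R: "R \<subseteq> V" "card R \<le> tower_bound J"
    and alt: "real (card (irregular A R \<eta>)) \<le> \<epsilon> * ?n \<or> real J * (\<eta>\<^sup>2 * \<epsilon>) * ?n \<le> energy A R"
    by blast
  have "\<not> real J * (\<eta>\<^sup>2 * \<epsilon>) * ?n \<le> energy A R"
  proof -
    have "1 * ?n < real J * (\<eta>\<^sup>2 * \<epsilon>) * ?n"
      using J card_V_pos by (intro mult_strict_right_mono) auto
    then show ?thesis using energy_le[of A R] by linarith
  qed
  then show ?thesis using R alt by blast
qed

text \<open>The counting lemma. If \<open>A\<close> is dense on three atoms \<open>x\<close>, \<open>y\<close>, \<open>x + y\<close>, the expected number of Schur
  triples across them is at least \<open>\<delta>^3\<close> times the square of the size of an atom. Regularity of just one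
  of the three atoms bounds the error by \<open>\<eta>\<close> times that square, through the Fourier expansion and
  Parseval's identity, so some triple would exist.\<close>

lemma sumfree_regular_atom:
  assumes A: "sumfree A" and V: "x \<in> V" "y \<in> V" and reg: "x \<notin> irregular A R \<eta>"
    and "0 < \<delta>" "\<eta> < \<delta> ^ 3"
    and dens: "\<delta> \<le> density A R x" "\<delta> \<le> density A R y" "\<delta> \<le> density A R (x + y)"
  shows False
proof -
  let ?h = "real (card (atom R 0))" and ?n = "real (card V)" and ?d = "density A R x"
  let ?Y = "A \<inter> atom R y" and ?Z = "A \<inter> atom R (x + y)"
  define f where "f = deviation A R x"
  define g :: "'a \<Rightarrow> real" where "g u = of_bool (u \<in> ?Y)" for u
  define k :: "'a \<Rightarrow> real" where "k u = of_bool (u \<in> ?Z)" for u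
  have AV: "A \<subseteq> V" using A by (simp add: sumfree_def)
  have h: "0 < ?h" using card_atom_pos by simp
  have sums: "(\<Sum>u\<in>V. g u) = real (card ?Y)" "(\<Sum>u\<in>V. k u) = real (card ?Z)"
    unfolding g_def k_def using AV by (intro card_eq_sum[symmetric]; blast)+
  have large: "\<delta> * ?h \<le> real (card ?Y)" "\<delta> * ?h \<le> real (card ?Z)"
    using dens h by (auto simp: density_def field_simps)
  have small: "real (card ?Y) \<le> ?h" "real (card ?Z) \<le> ?h"
    using card_Int_atom_le[of y A R] card_Int_atom_le[of "x + y" A R] V by auto
  have "f (u + v) * g u * k v = - ?d * (g u * k v)" if "u \<in> V" "v \<in> V" for u v
  proof (cases "u \<in> ?Y \<and> v \<in> ?Z")
    case True
    then have "u + v \<notin> A" using A by (auto simp: sumfree_def)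
    moreover have "u + v \<in> atom R x" using True V that by (auto simp: atom_def chr_add)
    ultimately show ?thesis by (simp add: f_def deviation_def)
  qed (auto simp: g_def k_def)
  then have "(\<Sum>u\<in>V. \<Sum>v\<in>V. f (u + v) * g u * k v) = (\<Sum>u\<in>V. \<Sum>v\<in>V. - ?d * (g u * k v))"
    by (intro sum.cong refl) auto
  also have "\<dots> = - ?d * (real (card ?Y) * real (card ?Z))"
    by (simp add: sum_product flip: sums) (simp add: sum_negf sum_distrib_left)
  finally have total: "(\<Sum>r\<in>V. fourier f r * fourier g r * fourier k r) = - (?n * (?d * (real (card ?Y) * real (card ?Z))))"
    by (simp add: sum_fourier_triple)
  have "?n * (\<delta> * ((\<delta> * ?h) * (\<delta> * ?h))) \<le> ?n * (?d * (real (card ?Y) * real (card ?Z)))"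
    using dens(1) large h assms(5) by (intro mult_left_mono mult_mono) auto
  also have "\<dots> = \<bar>\<Sum>r\<in>V. fourier f r * fourier g r * fourier k r\<bar>" by (simp add: total density_nonneg)
  also have "\<dots> \<le> (\<Sum>r\<in>V. \<bar>fourier f r * fourier g r * fourier k r\<bar>)" by (rule sum_abs)
  also have "\<dots> \<le> (\<Sum>r\<in>V. (\<eta> * ?h) * (((fourier g r)\<^sup>2 + (fourier k r)\<^sup>2) / 2))"
  proof (rule sum_mono)
    fix r assume "r \<in> V"
    then have ftf: "\<bar>fourier f r\<bar> \<le> \<eta> * ?h" using reg V by (auto simp: irregular_def f_def not_less)
    have "\<bar>fourier g r * fourier k r\<bar> \<le> ((fourier g r)\<^sup>2 + (fourier k r)\<^sup>2) / 2"
      using sum_squares_bound[of "\<bar>fourier g r\<bar>" "\<bar>fourier k r\<bar>"] by (simp add: abs_mult)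
    then have "\<bar>fourier f r\<bar> * \<bar>fourier g r * fourier k r\<bar> \<le> (\<eta> * ?h) * (((fourier g r)\<^sup>2 + (fourier k r)\<^sup>2) / 2)"
      using ftf by (intro mult_mono) auto
    then show "\<bar>fourier f r * fourier g r * fourier k r\<bar> \<le> (\<eta> * ?h) * (((fourier g r)\<^sup>2 + (fourier k r)\<^sup>2) / 2)"
      by (simp add: abs_mult mult_ac)
  qed
  also have "\<dots> = (\<eta> * ?h) * ((?n * real (card ?Y) + ?n * real (card ?Z)) / 2)"
  proof -
    have "(g u)\<^sup>2 = g u" "(k u)\<^sup>2 = k u" for u by (simp_all add: g_def k_def)
    then have "(\<Sum>r\<in>V. (fourier g r)\<^sup>2) = ?n * real (card ?Y)" "(\<Sum>r\<in>V. (fourier k r)\<^sup>2) = ?n * real (card ?Z)"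
      by (simp_all add: parseval sums)
    then show ?thesis by (simp add: sum.distrib flip: sum_distrib_left sum_divide_distrib)
  qed
  finally have le: "?n * (\<delta> ^ 3 * ?h\<^sup>2) \<le> (\<eta> * ?h) * ((?n * real (card ?Y) + ?n * real (card ?Z)) / 2)"
    by (simp add: power2_eq_square power3_eq_cube mult_ac)
  have n: "0 < ?n" using card_V_pos by simp
  have "0 \<le> \<eta> * ?h" using reg V(1) abs_ge_zero[of "fourier (deviation A R x) x"]
    by (force simp: irregular_def not_less)
  then have "(\<eta> * ?h) * ((?n * real (card ?Y) + ?n * real (card ?Z)) / 2) \<le> (\<eta> * ?h) * (?n * ?h)"
  proof (rule mult_left_mono[rotated])
    have "?n * real (card ?Y) \<le> ?n * ?h" "?n * real (card ?Z) \<le> ?n * ?h"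
      using small by (auto intro: mult_left_mono)
    moreover have "(u + v) / 2 \<le> w" if "u \<le> w" "v \<le> w" for u v w :: real using that by argo
    ultimately show "(?n * real (card ?Y) + ?n * real (card ?Z)) / 2 \<le> ?n * ?h" by blast
  qed
  with le have "(?n * ?h\<^sup>2) * \<delta> ^ 3 \<le> (?n * ?h\<^sup>2) * \<eta>" by (simp add: power2_eq_square mult_ac)
  moreover have "0 < ?n * ?h\<^sup>2" using n h by (intro mult_pos_pos zero_less_power)
  ultimately have "\<delta> ^ 3 \<le> \<eta>" by (rule mult_left_le_imp_le)
  then show False using assms(6) by simp
qed

text \<open>These sets serve as containers: for fixed \<open>K\<close> their number is only polynomial in \<open>card V\<close>
  (\<open>card_periodic_sets_le\<close>).\<close>

definition periodic_sets :: "nat \<Rightarrow> 'a set set" where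
  "periodic_sets K = {B. B \<subseteq> V \<and> (\<exists>R\<subseteq>V. card R \<le> K \<and> (\<forall>x\<in>B. atom R x \<subseteq> B))}"

text \<open>The container \<open>B\<close> consists of the regular atoms on which \<open>A\<close> has density at least \<open>\<delta>\<close>; the counting
  lemma makes it sum-free. What is lost lies in irregular atoms or in atoms of small density.\<close>

theorem sumfree_structure:
  assumes A: "sumfree A" and \<delta>: "0 < \<delta>" and J: "1 < real J * ((\<delta> ^ 3 / 2)\<^sup>2 * \<delta>)"
  shows "\<exists>B \<in> periodic_sets (tower_bound J). sumfree B \<and> real (card (A - B)) \<le> 2 * \<delta> * real (card V)"
proof -
  let ?\<eta> = "\<delta> ^ 3 / 2" and ?n = "real (card V)"
  have AV: "A \<subseteq> V" using A by (simp add: sumfree_def)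
  obtain R where R: "R \<subseteq> V" "card R \<le> tower_bound J"
    and irr: "real (card (irregular A R ?\<eta>)) \<le> \<delta> * ?n"
    using arithmetic_regularity[OF AV \<delta> _ J] \<delta> by auto
  define B where "B = {x \<in> V - irregular A R ?\<eta>. \<delta> \<le> density A R x}"
  have "atom R x \<subseteq> B" if "x \<in> B" for x
  proof
    fix y assume y: "y \<in> atom R x"
    then have "y \<in> V" using atom_subset by blast
    then show "y \<in> B"
      using that irregular_cong[of x y] density_eq[OF y] y unfolding B_def by auto
  qed
  then have "B \<in> periodic_sets (tower_bound J)"
    using R by (auto simp: periodic_sets_def B_def)
  moreover have "sumfree B"
    unfolding sumfree_def
  proof (intro conjI ballI notI)
    fix x y assume xy: "x \<in> B" "y \<in> B" "x + y \<in> B"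
    show False
      by (rule sumfree_regular_atom[OF A, of x y R ?\<eta> \<delta>]) (use xy \<delta> in \<open>auto simp: B_def\<close>)
  qed (auto simp: B_def)
  moreover have "real (card (A - B)) \<le> 2 * \<delta> * ?n"
  proof -
    let ?C = "{x \<in> A. density A R x < \<delta>}"
    have "A - B \<subseteq> irregular A R ?\<eta> \<union> ?C" using AV by (auto simp: B_def)
    then have "card (A - B) \<le> card (irregular A R ?\<eta> \<union> ?C)"
      using sumfree_finite[OF A] finite_subset[OF irregular_subset finite_V] by (intro card_mono) auto
    also have "\<dots> \<le> card (irregular A R ?\<eta>) + card ?C" by (rule card_Un_le)
    finally have *: "card (A - B) \<le> card (irregular A R ?\<eta>) + card ?C" .
    let ?f = "\<lambda>x. of_bool (density A R x < \<delta>) :: real"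
    have "real (card ?C) = (\<Sum>x\<in>V. of_bool (x \<in> ?C))" using AV by (intro card_eq_sum) auto
    also have "\<dots> = (\<Sum>x\<in>V. ?f x * of_bool (x \<in> A))" by (rule sum.cong) auto
    also have "\<dots> = (\<Sum>x\<in>V. ?f x * density A R x)"
      using AV by (rule sum_mult_density[symmetric]) (simp only: density_eq)
    also have "\<dots> \<le> (\<Sum>x\<in>V. \<delta>)" by (rule sum_mono) (use \<delta> in auto)
    finally have "real (card ?C) \<le> \<delta> * ?n" by (simp add: mult.commute)
    then show ?thesis using * irr by linarith
  qed
  ultimately show ?thesis by blast
qed

text \<open>A periodic set is determined by a list of \<open>K\<close> characters, padded with the trivial one, and by the
  set of sign patterns of its elements.\<close>

lemma card_periodic_sets_le:
  "finite (periodic_sets K) \<and> card (periodic_sets K) \<le> card V ^ K * 2 ^ 2 ^ K"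
proof -
  let ?L = "{rs. set rs \<subseteq> V \<and> length rs = K}" and ?W = "Pow {bs :: bool list. set bs \<subseteq> UNIV \<and> length bs = K}"
  let ?F = "\<lambda>(rs, P). {x \<in> V. map (\<lambda>r. chr r x = 1) rs \<in> P}"
  have fin: "finite ?L" "finite ?W" using finite_V
    by (auto intro: finite_lists_length_eq simp: finite_lists_length_eq[of "UNIV :: bool set" K, simplified])
  have sub: "periodic_sets K \<subseteq> ?F ` (?L \<times> ?W)"
  proof
    fix B assume "B \<in> periodic_sets K"
    then obtain R where R: "B \<subseteq> V" "R \<subseteq> V" "card R \<le> K" and per: "\<And>x. x \<in> B \<Longrightarrow> atom R x \<subseteq> B"
      by (auto simp: periodic_sets_def)
    obtain xs where xs: "set xs = R" "length xs = card R"
      using finite_distinct_list[OF finite_subset[OF R(2) finite_V]] distinct_card by metis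
    define rs where "rs = xs @ replicate (K - card R) 0"
    define P where "P = (\<lambda>x. map (\<lambda>r. chr r x = 1) rs) ` B"
    have rs: "rs \<in> ?L" "set xs \<subseteq> set rs" using xs R by (auto simp: rs_def)
    have "P \<in> ?W" using rs by (auto simp: P_def)
    moreover have "B = {x \<in> V. map (\<lambda>r. chr r x = 1) rs \<in> P}"
    proof
      show "B \<subseteq> {x \<in> V. map (\<lambda>r. chr r x = 1) rs \<in> P}" using R by (auto simp: P_def)
      show "{x \<in> V. map (\<lambda>r. chr r x = 1) rs \<in> P} \<subseteq> B"
      proof
        fix x assume "x \<in> {x \<in> V. map (\<lambda>r. chr r x = 1) rs \<in> P}"
        then obtain b where b: "x \<in> V" "b \<in> B" "\<forall>r\<in>set rs. (chr r x = 1) = (chr r b = 1)"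
          by (auto simp: P_def)
        have "chr r x = chr r b" if "r \<in> R" for r
        proof -
          have "chr r x = 1 \<longleftrightarrow> chr r b = 1" using b(3) rs(2) that xs(1) by blast
          then show ?thesis using chr_cases[of r x] chr_cases[of r b] by auto
        qed
        then have "x \<in> atom R b" using b(1) by (simp add: atom_def)
        then show "x \<in> B" using per b(2) by blast
      qed
    qed
    ultimately show "B \<in> ?F ` (?L \<times> ?W)" using rs(1) by blast
  qed
  have "card (periodic_sets K) \<le> card (?L \<times> ?W)" using surj_card_le[OF _ sub] fin by blast
  also have "\<dots> = card V ^ K * 2 ^ 2 ^ K"
    using card_lists_length_eq[OF finite_V, of K] card_lists_length_eq[of "UNIV :: bool set" K]
    by (simp add: card_cartesian_product card_Pow finite_lists_length_eq[of "UNIV :: bool set" K, simplified])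
  finally show ?thesis using finite_subset[OF sub] fin by blast
qed

end

section \<open>Maximal sum-free sets and link graphs\<close>

lemma card_UN_le_mult:
  assumes "finite I" "\<And>i. i \<in> I \<Longrightarrow> real (card (F i)) \<le> c"
  shows "real (card (\<Union>i\<in>I. F i)) \<le> real (card I) * c"
proof -
  have "real (card (\<Union>i\<in>I. F i)) \<le> (\<Sum>i\<in>I. real (card (F i)))"
    using card_UN_le[OF assms(1), of F] by (simp flip: of_nat_sum)
  also have "\<dots> \<le> (\<Sum>i\<in>I. c)" using assms(2) by (rule sum_mono)
  finally show ?thesis by simp
qed

lemma sqrt_2_power: "sqrt 2 ^ m = 2 powr (real m / 2)"
  by (simp add: powr_half_sqrt[symmetric] powr_powr flip: powr_realpow)

context boolean_duality
begin

definition msf :: "'a set \<Rightarrow> bool" where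
  "msf A \<longleftrightarrow> sumfree A \<and> (\<forall>B. sumfree B \<and> A \<subseteq> B \<longrightarrow> B = A)"

definition link :: "'a set \<Rightarrow> 'a \<Rightarrow> 'a \<Rightarrow> bool" where
  "link S x y \<longleftrightarrow> x + y \<in> S"

text \<open>The three edge labels of a triangle satisfy \<open>(x + y) + (y + z) = x + z\<close>, so a triangle in the link
  graph is a Schur triple in \<open>S\<close>.\<close>

lemma triangle_free_link: "sumfree S \<Longrightarrow> triangle_free_graph (link S)"
proof
  fix x y z
  assume S: "sumfree S" and "link S x y" "link S y z" "link S x z"
  moreover have "(x + y) + (y + z) = x + z" by (simp add: add.assoc)
  ultimately show False unfolding link_def sumfree_def by metis
qed (simp add: link_def add.commute)

lemma msf_sumfree: "msf A \<Longrightarrow> sumfree A"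
  by (simp add: msf_def)

lemma finite_msf: "finite {A. msf A \<and> P A}"
  by (rule finite_subset[of _ "Pow V"]) (auto simp: msf_def sumfree_def finite_V)

text \<open>In characteristic 2, each way in which \<open>x\<close> could form a Schur triple with elements of \<open>A\<close> can be
  solved for \<open>x\<close> as a sum of two elements of \<open>A\<close>.\<close>

lemma msf_eq_sum:
  assumes "msf A" "x \<in> V" "x \<notin> A" "x \<noteq> 0"
  shows "\<exists>a\<in>A. \<exists>b\<in>A. x = a + b"
proof (rule ccontr)
  assume neg: "\<not> ?thesis"
  have A: "A \<subseteq> V" "\<And>a b. a \<in> A \<Longrightarrow> b \<in> A \<Longrightarrow> a + b \<notin> A" "0 \<notin> A"
    using assms(1) sumfree_zero by (auto simp: msf_def sumfree_def)
  have "x + a \<notin> A" "a + x \<notin> A" if "a \<in> A" for a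
    using neg that by (metis add_self_left add.commute)+
  then have "sumfree (insert x A)"
    using A assms neg by (auto simp: sumfree_def add_eq_iff)
  then show False using assms(1,3) unfolding msf_def by blast
qed

lemma sumfree_disjoint_sums: "sumfree A \<Longrightarrow> a \<in> A \<Longrightarrow> b \<in> A \<Longrightarrow> a + b \<notin> A"
  by (simp add: sumfree_def)

text \<open>Once \<open>C = A - B\<close> is known, \<open>A \<inter> B\<close> is a maximal independent set. Indeed an element of
  \<open>B\<close> outside \<open>A\<close> is a sum of two elements of \<open>A\<close>, not both in \<open>B\<close>; unless both are in \<open>C\<close>, one of them
  is a neighbour in the link graph of \<open>C\<close>. Sums of two elements of \<open>C\<close> are never in \<open>A\<close> and are
  removed from the vertex set.\<close>

lemma msf_mis_link:
  assumes "msf A" "sumfree B"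
  shows "A \<inter> B \<in> mis (link (A - B)) (B - {c + d |c d. c \<in> A - B \<and> d \<in> A - B})"
  unfolding mis_def link_def
proof (intro CollectI conjI ballI)
  note A = msf_sumfree[OF assms(1)]
  show "A \<inter> B \<subseteq> B - {c + d |c d. c \<in> A - B \<and> d \<in> A - B}"
    using sumfree_disjoint_sums[OF A] by blast
  show "x + y \<notin> A - B" if "x \<in> A \<inter> B" "y \<in> A \<inter> B" for x y
    using sumfree_disjoint_sums[OF A] that by blast
  fix x assume x: "x \<in> B - {c + d |c d. c \<in> A - B \<and> d \<in> A - B} - A \<inter> B"
  then have "x \<in> V" "x \<noteq> 0" "x \<notin> A" using assms(2) sumfree_zero by (auto simp: sumfree_def)
  then obtain a b where ab: "a \<in> A" "b \<in> A" "x = a + b" using msf_eq_sum[OF assms(1)] by blast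
  have "\<not> (a \<in> B \<and> b \<in> B)" using sumfree_disjoint_sums[OF assms(2)] ab x by blast
  moreover have "\<not> (a \<notin> B \<and> b \<notin> B)" using ab x by blast
  moreover have "x + a = b" "x + b = a" using ab by (auto simp: add.assoc add.commute)
  ultimately show "\<exists>y\<in>A \<inter> B. x + y \<in> A - B" using ab by (metis DiffI IntI)
qed

lemma msf_mis_odd:
  assumes "msf A"
  shows "A \<inter> odd_part r \<in> mis (link (A \<inter> even_part r)) (odd_part r)"
proof -
  let ?C = "A - odd_part r"
  have AV: "A \<subseteq> V" using assms by (simp add: msf_def sumfree_def)
  have "?C = A \<inter> even_part r" using AV parts_partition[of r] by blast
  moreover have "odd_part r - {c + d |c d. c \<in> ?C \<and> d \<in> ?C} = odd_part r"
    unfolding \<open>?C = A \<inter> even_part r\<close> by (auto simp: odd_part_def even_part_def chr_add)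
  ultimately show ?thesis using msf_mis_link[OF assms sumfree_odd_part[of r]] by simp
qed

definition small_sets :: "real \<Rightarrow> 'a set set" where
  "small_sets \<epsilon> = {S. S \<subseteq> V \<and> real (card S) \<le> \<epsilon> * real (card V)}"

lemma finite_small_sets: "finite (small_sets \<epsilon>)"
  by (rule finite_subset[of _ "Pow V"]) (auto simp: small_sets_def finite_V)

text \<open>A set \<open>A\<close> near \<open>B\<close> is recovered from \<open>B\<close>, the small set \<open>A - B\<close>, and a maximal independent set in a
  triangle-free graph on at most \<open>card V / 3\<close> vertices.\<close>

lemma card_msf_near_small_le:
  assumes "finite P"
  shows "real (card {A. msf A \<and> (\<exists>B\<in>P. sumfree B \<and> 3 * card B \<le> card V \<and> A - B \<in> small_sets \<epsilon>)})
    \<le> real (card P) * real (card (small_sets \<epsilon>)) * 2 powr (real (card V) / 6)"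
proof -
  let ?Q = "{(B, C) \<in> P \<times> small_sets \<epsilon>. sumfree B \<and> 3 * card B \<le> card V \<and> sumfree C}"
  let ?W = "\<lambda>B C. B - {c + d |c d. c \<in> C \<and> d \<in> C}"
  let ?F = "\<lambda>(B, C). (\<lambda>I. I \<union> C) ` mis (link C) (?W B C)"
  have fin: "finite (P \<times> small_sets \<epsilon>)" using assms finite_small_sets by blast
  have finQ: "finite ?Q" by (rule finite_subset[OF _ fin]) auto
  have finF: "finite (?F q)" if "q \<in> ?Q" for q
    using that sumfree_finite by auto
  have sub: "{A. msf A \<and> (\<exists>B\<in>P. sumfree B \<and> 3 * card B \<le> card V \<and> A - B \<in> small_sets \<epsilon>)} \<subseteq> (\<Union>q\<in>?Q. ?F q)"
  proof
    fix A assume "A \<in> {A. msf A \<and> (\<exists>B\<in>P. sumfree B \<and> 3 * card B \<le> card V \<and> A - B \<in> small_sets \<epsilon>)}"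
    then obtain B where B: "msf A" "B \<in> P" "sumfree B" "3 * card B \<le> card V" "A - B \<in> small_sets \<epsilon>"
      by blast
    have "(B, A - B) \<in> ?Q" using B sumfree_subset[OF msf_sumfree[OF B(1)], of "A - B"] by auto
    moreover have "A \<in> ?F (B, A - B)"
      using msf_mis_link[OF B(1,3)] by (auto intro!: image_eqI[of _ _ "A \<inter> B"])
    ultimately show "A \<in> (\<Union>q\<in>?Q. ?F q)" by (rule UN_I)
  qed
  have "card {A. msf A \<and> (\<exists>B\<in>P. sumfree B \<and> 3 * card B \<le> card V \<and> A - B \<in> small_sets \<epsilon>)} \<le> card (\<Union>q\<in>?Q. ?F q)"
    by (rule card_mono[OF _ sub], rule finite_UN_I[OF finQ finF])
  also have "real (card (\<Union>q\<in>?Q. ?F q)) \<le> real (card ?Q) * 2 powr (real (card V) / 6)"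
  proof (rule card_UN_le_mult[OF finQ])
    fix q assume q: "q \<in> ?Q"
    obtain B C where BC: "q = (B, C)" by (cases q)
    interpret triangle_free_graph "link C" using q BC by (auto intro: triangle_free_link)
    have fB: "finite B" "3 * card B \<le> card V" using q BC sumfree_finite by auto
    have "card (?F q) \<le> card (mis (link C) (?W B C))"
      using fB by (simp add: BC card_image_le)
    also have "real (card (mis (link C) (?W B C))) \<le> sqrt 2 ^ card (?W B C)"
      by (rule card_mis_le) (simp add: fB(1))
    also have "\<dots> \<le> sqrt 2 ^ card B"
      by (rule power_increasing) (use fB in \<open>auto intro: card_mono\<close>)
    also have "\<dots> \<le> 2 powr (real (card V) / 6)"
      unfolding sqrt_2_power by (rule powr_mono) (use fB(2) in auto)
    finally show "real (card (?F q)) \<le> 2 powr (real (card V) / 6)" by simp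
  qed
  also have "\<dots> \<le> real (card (P \<times> small_sets \<epsilon>)) * 2 powr (real (card V) / 6)"
    by (intro mult_right_mono) (use fin in \<open>auto intro!: card_mono\<close>)
  finally show ?thesis by (simp add: card_cartesian_product)
qed

section \<open>Sets alternating along translations\<close>

text \<open>For \<open>s\<close> in the even part, these are the sets containing exactly one element from each pair
  \<open>{x, x + s}\<close> of the odd part.\<close>

definition alternating :: "'a \<Rightarrow> 'a \<Rightarrow> 'a set set" where
  "alternating r s = {I. I \<subseteq> odd_part r \<and> (\<forall>x\<in>odd_part r. x \<in> I \<longleftrightarrow> x + s \<notin> I)}"

lemma finite_alternating: "finite (alternating r s)"
  by (rule finite_subset[of _ "Pow (odd_part r)"]) (auto simp: alternating_def)

lemma odd_part_add: "s \<in> even_part r \<Longrightarrow> x \<in> odd_part r \<Longrightarrow> x + s \<in> odd_part r"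
  by (simp add: odd_part_def even_part_def chr_add)

lemma card_alternating_subset:
  fixes D T :: "'a set"
  assumes "finite D" "T \<subseteq> D" and closed: "\<And>x. x \<in> D \<Longrightarrow> x + s \<in> D"
    and alt: "\<And>x. x \<in> D \<Longrightarrow> x \<in> T \<longleftrightarrow> x + s \<notin> T"
  shows "2 * card T = card D"
proof -
  have "(\<lambda>x. x + s) ` T = D - T"
  proof
    show "(\<lambda>x. x + s) ` T \<subseteq> D - T" using assms(2) closed alt by blast
    show "D - T \<subseteq> (\<lambda>x. x + s) ` T"
    proof
      fix y assume "y \<in> D - T"
      then have "y + s \<in> T" using alt by blast
      moreover have "y = (y + s) + s" by (simp add: add.assoc)
      ultimately show "y \<in> (\<lambda>x. x + s) ` T" by blast
    qed
  qed
  then have "card (D - T) = card T" using card_image[of "\<lambda>x. x + s" T] by (simp add: inj_on_def)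
  then show ?thesis
    using card_Diff_subset[OF finite_subset[OF assms(2,1)] assms(2)] card_mono[OF assms(1,2)] by linarith
qed

lemma card_alternating_set:
  assumes "s \<in> even_part r" "I \<in> alternating r s"
  shows "2 * card I = card (odd_part r)"
  by (rule card_alternating_subset[of _ _ s])
    (use assms(2) odd_part_add[OF assms(1)] in \<open>auto simp only: alternating_def finite_parts mem_Collect_eq\<close>)

text \<open>A character \<open>p\<close> with \<open>chr p s = -1\<close> separates the two elements of each pair, so the elements of the
  odd part with \<open>chr p x = 1\<close> form a transversal \<open>T\<close>, and a subset of \<open>T\<close> can be prescribed freely.\<close>

lemma card_alternating_ge:
  assumes "s \<in> even_part r" "s \<noteq> 0" "r \<in> V" "r \<noteq> 0"
  shows "2 powr (real (card V) / 4) \<le> real (card (alternating r s))"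
proof -
  obtain p where p: "p \<in> V" "chr p s = - 1"
    using chr_nondegenerate[of s] assms(1,2) by (auto simp: even_part_def)
  let ?O = "odd_part r"
  define T where "T = {x \<in> ?O. chr p x = 1}"
  have TO: "T \<subseteq> ?O" by (auto simp: T_def)
  have step: "x + s \<in> T \<longleftrightarrow> x \<notin> T" if "x \<in> ?O" for x
    using that odd_part_add[OF assms(1) that] p by (auto simp: T_def chr_add)
  have "2 * card T = card ?O"
  proof (rule card_alternating_subset)
    show "x \<in> T \<longleftrightarrow> x + s \<notin> T" if "x \<in> ?O" for x using step[OF that] by blast
    show "x + s \<in> ?O" if "x \<in> ?O" for x using odd_part_add[OF assms(1) that] .
  qed (simp_all add: TO)
  then have cT: "4 * card T = card V" using card_odd_part[OF assms(3,4)] by linarith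
  let ?F = "\<lambda>J. J \<union> {x \<in> ?O. x \<notin> T \<and> x + s \<notin> J}"
  have "card (Pow T) \<le> card (alternating r s)"
  proof (rule card_inj_on_le[OF _ _ finite_alternating])
    show "inj_on ?F (Pow T)"
      by (rule inj_on_inverseI[where g = "\<lambda>I. I \<inter> T"]) blast
    show "?F ` Pow T \<subseteq> alternating r s"
    proof (rule image_subsetI)
      fix J assume "J \<in> Pow T"
      then have J: "J \<subseteq> T" by blast
      have "x \<in> ?F J \<longleftrightarrow> x + s \<notin> ?F J" if x: "x \<in> ?O" for x
      proof -
        have shift: "x + s + s = x" by (simp add: add.assoc)
        show ?thesis
          using J step[OF x] odd_part_add[OF assms(1) x] x by (cases "x \<in> T") (auto simp: shift)
      qed
      then show "?F J \<in> alternating r s" using J TO unfolding alternating_def by blast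
    qed
  qed
  then have "2 ^ card T \<le> card (alternating r s)"
    using finite_subset[OF TO] by (simp add: card_Pow)
  then have "(2::real) ^ card T \<le> real (card (alternating r s))"
    by (metis of_nat_le_iff of_nat_numeral of_nat_power)
  moreover have "(2::real) ^ card T = 2 powr (real (card V) / 4)"
  proof -
    have "real (card T) = real (card V) / 4" using cT by linarith
    then show ?thesis using powr_realpow[of "2::real" "card T"] by (metis zero_less_numeral)
  qed
  ultimately show ?thesis by simp
qed

text \<open>Alternating along both \<open>s\<close> and \<open>t\<close> determines a set on each coset of the group generated by \<open>s\<close>
  and \<open>t\<close> from a single value. Two characters cut out a set \<open>T\<close> of representatives in the odd part; it is
  disjoint from two of its translates there, which gives \<open>6 * card T \<le> card V\<close>.\<close>

lemma card_alternating_Int_le: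
  assumes "s \<in> even_part r" "s \<noteq> 0" "t \<in> even_part r" "t \<noteq> 0" "s \<noteq> t" "r \<in> V" "r \<noteq> 0"
  shows "real (card (alternating r s \<inter> alternating r t)) \<le> 2 powr (real (card V) / 6)"
proof -
  let ?O = "odd_part r"
  have stV: "s \<in> V" "t \<in> V" using assms by (auto simp: even_part_def)
  obtain p where p: "p \<in> V" "chr p s = - 1" using chr_nondegenerate[OF stV(1)] assms(2) by blast
  \<comment> \<open>A nonzero element of the group generated by \<open>s\<close> and \<open>t\<close> in the
    kernel of \<open>p\<close>: translation by \<open>s\<close> reduces to the kernel of \<open>p\<close>, and
    translation by \<open>u\<close> then reduces to \<open>T\<close>.\<close>
  define u where "u = (if chr p t = 1 then t else s + t)"
  have u: "u \<in> V" "u \<noteq> 0" "u \<in> even_part r" "chr p u = 1"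
    using assms stV p chr_cases[of p t] by (auto simp: u_def even_part_def chr_add)
  obtain q where q: "q \<in> V" "chr q u = - 1" using chr_nondegenerate[OF u(1,2)] by blast
  define T where "T = {x \<in> ?O. chr p x = 1 \<and> chr q x = 1}"
  have TO: "T \<subseteq> ?O" by (auto simp: T_def)
  have finT: "finite T" using finite_subset[OF TO] by simp
  have "inj_on (\<lambda>I. I \<inter> T) (alternating r s \<inter> alternating r t)"
  proof (rule inj_onI)
    fix I I'
    assume I: "I \<in> alternating r s \<inter> alternating r t" and I': "I' \<in> alternating r s \<inter> alternating r t"
      and eq: "I \<inter> T = I' \<inter> T"
    have shift_s: "x \<in> I \<longleftrightarrow> x \<in> I'" if "x \<in> ?O" "x + s \<in> I \<longleftrightarrow> x + s \<in> I'" for x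
      using that I I' by (auto simp: alternating_def)
    have shift_t: "x \<in> I \<longleftrightarrow> x \<in> I'" if "x \<in> ?O" "x + t \<in> I \<longleftrightarrow> x + t \<in> I'" for x
      using that I I' by (auto simp: alternating_def)
    have shift_u: "x \<in> I \<longleftrightarrow> x \<in> I'" if x: "x \<in> ?O" and "x + u \<in> I \<longleftrightarrow> x + u \<in> I'" for x
    proof (cases "chr p t = 1")
      case True
      then show ?thesis using that shift_t by (simp add: u_def)
    next
      case False
      then have "x + s + t \<in> I \<longleftrightarrow> x + s + t \<in> I'" using that by (simp add: u_def add.assoc)
      then show ?thesis using shift_s[OF x] shift_t[OF odd_part_add[OF assms(1) x]] by blast
    qed
    have even_p: "x \<in> I \<longleftrightarrow> x \<in> I'" if x: "x \<in> ?O" "chr p x = 1" for x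
    proof (cases "chr q x = 1")
      case True
      then have "x \<in> T" using x by (simp add: T_def)
      then show ?thesis using eq by blast
    next
      case False
      then have "x + u \<in> T" using x u q odd_part_add[OF u(3) x(1)] by (simp add: T_def chr_add)
      then show ?thesis using eq shift_u[OF x(1)] by blast
    qed
    have "x \<in> I \<longleftrightarrow> x \<in> I'" if x: "x \<in> ?O" for x
    proof (cases "chr p x = 1")
      case False
      then have "chr p (x + s) = 1" using p by (simp add: chr_add)
      then show ?thesis using shift_s[OF x] even_p[OF odd_part_add[OF assms(1) x]] by blast
    qed (rule even_p[OF x])
    moreover have "I \<subseteq> ?O" "I' \<subseteq> ?O" using I I' by (simp_all add: alternating_def)
    ultimately show "I = I'" by blast
  qed
  then have "card (alternating r s \<inter> alternating r t) \<le> card (Pow T)"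
    by (rule card_inj_on_le) (use finT in auto)
  then have le: "card (alternating r s \<inter> alternating r t) \<le> 2 ^ card T" by (simp add: card_Pow finT)
  let ?Tu = "(\<lambda>x. x + u) ` T" and ?Ts = "(\<lambda>x. x + s) ` T"
  have cs: "card ?Tu = card T" "card ?Ts = card T" by (auto intro!: card_image simp: inj_on_def)
  have "chr p x = 1 \<and> chr q x = 1" if "x \<in> T" for x using that by (simp add: T_def)
  moreover from this have "chr p x = 1 \<and> chr q x = - 1" if "x \<in> ?Tu" for x
    using that q u(4) by (clarsimp simp: chr_add)
  moreover from calculation(1) have "chr p x = - 1" if "x \<in> ?Ts" for x
    using that p by (clarsimp simp: chr_add)
  ultimately have "T \<inter> ?Tu = {}" "(T \<union> ?Tu) \<inter> ?Ts = {}" by fastforce+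
  then have "card (T \<union> ?Tu \<union> ?Ts) = 3 * card T" using cs finT by (simp add: card_Un_disjoint)
  moreover have "card (T \<union> ?Tu \<union> ?Ts) \<le> card ?O"
    by (rule card_mono) (use TO odd_part_add assms(1) u(3) in auto)
  ultimately have "6 * card T \<le> card V" using card_odd_part[OF assms(6,7)] by linarith
  then have "real (card T) \<le> real (card V) / 6" by linarith
  then have "(2::real) ^ card T \<le> 2 powr (real (card V) / 6)"
    by (simp flip: powr_realpow)
  moreover have "real (card (alternating r s \<inter> alternating r t)) \<le> 2 ^ card T"
    using le by (metis of_nat_le_iff of_nat_numeral of_nat_power)
  ultimately show ?thesis by linarith
qed

lemma mis_link_singleton:
  assumes "s \<in> even_part r" "I \<in> mis (link {s}) (odd_part r)"
  shows "I \<in> alternating r s"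
proof -
  have "x \<in> I \<longleftrightarrow> x + s \<notin> I" if "x \<in> odd_part r" for x
  proof
    assume "x \<in> I"
    moreover have "link {s} x (x + s)" by (simp add: link_def)
    ultimately show "x + s \<notin> I" using mis_independent[OF assms(2)] by blast
  next
    assume "x + s \<notin> I"
    moreover have "y = x + s" if "link {s} x y" for y
      using that by (metis link_def singletonD add_self_left)
    ultimately show "x \<in> I" using mis_dominated[OF assms(2) that] by blast
  qed
  then show ?thesis using assms(2) by (auto simp: alternating_def mis_def)
qed

text \<open>The link graph of two elements is a union of 4-cycles \<open>x, x + s, x + s + t, x + t\<close>, whose only
  maximal independent sets are the two diagonals.\<close>

lemma mis_link_pair:
  assumes "s \<in> even_part r" "t \<in> even_part r" "I \<in> mis (link {s, t}) (odd_part r)"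
  shows "I \<in> alternating r s \<inter> alternating r t"
proof -
  have indep: "x + s \<notin> I" "x + t \<notin> I" if "x \<in> I" for x
  proof -
    have "link {s, t} x (x + s)" "link {s, t} x (x + t)" by (simp_all add: link_def)
    then show "x + s \<notin> I" "x + t \<notin> I"
      using mis_independent[OF assms(3) that] by blast+
  qed
  have dom: "x + s \<in> I \<or> x + t \<in> I" if "x \<in> odd_part r" "x \<notin> I" for x
  proof -
    obtain y where y: "y \<in> I" "link {s, t} x y"
      using mis_dominated[OF assms(3) \<open>x \<in> odd_part r\<close> \<open>x \<notin> I\<close>] by blast
    then have "x + y = s \<or> x + y = t" by (simp add: link_def)
    then have "y = x + s \<or> y = x + t" by (metis add_self_left)
    then show ?thesis using y(1) by blast
  qed
  have both: "x + s \<in> I \<and> x + t \<in> I" if x: "x \<in> odd_part r" "x \<notin> I" for x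
  proof -
    have e1: "x + s + s = x" and e2: "x + t + t = x" by (simp_all add: add.assoc)
    have e3: "x + t + s = x + s + t" by (simp add: ac_simps)
    have "x + s \<in> I \<or> x + s + t \<in> I"
      using dom[OF odd_part_add[OF assms(1) x(1)]] x(2) unfolding e1 by blast
    moreover have "x + t \<in> I \<or> x + s + t \<in> I"
      using dom[OF odd_part_add[OF assms(2) x(1)]] x(2) unfolding e2 e3 by blast
    ultimately show ?thesis
      using dom[OF x] indep(2)[of "x + s"] indep(1)[of "x + t"] unfolding e3 by blast
  qed
  have "I \<subseteq> odd_part r" using assms(3) by (simp add: mis_def)
  then show ?thesis using indep both unfolding alternating_def by blast
qed

text \<open>Each of three elements \<open>s\<close> of \<open>S\<close> translates at most \<open>card (odd_part r - U)\<close> elements of \<open>U\<close> out of \<open>U\<close>,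
  so some element of \<open>U\<close> keeps all three of its translates.\<close>

lemma link_degree_ge_3:
  assumes S: "S \<subseteq> even_part r" "3 \<le> card S" "finite S"
    and U: "U \<subseteq> odd_part r" "3 * card (odd_part r) < 4 * card U"
  shows "\<exists>x\<in>U. 3 \<le> card {u \<in> U. link S x u}"
proof -
  obtain S3 where S3: "S3 \<subseteq> S" "card S3 = 3" "finite S3"
    using S by (meson obtain_subset_with_card_n)
  have finU: "finite U" using finite_subset[OF U(1)] by simp
  let ?O = "odd_part r"
  let ?bad = "\<lambda>s. {x \<in> U. x + s \<notin> U}"
  have "card (?bad s) \<le> card (?O - U)" if "s \<in> S3" for s
    by (rule card_inj_on_le[of "\<lambda>x. x + s"])
      (use that S3 S U odd_part_add[of s r] in \<open>auto simp: inj_on_def\<close>)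
  then have "card (\<Union>s\<in>S3. ?bad s) \<le> 3 * card (?O - U)"
    using card_UN_le[OF S3(3), of ?bad] sum_bounded_above[of S3 "\<lambda>s. card (?bad s)" "card (?O - U)"] S3(2)
    by fastforce
  also have "\<dots> < card U"
    using U card_Diff_subset[OF finU U(1)] card_mono[OF _ U(1)] by simp
  finally have "\<not> U \<subseteq> (\<Union>s\<in>S3. ?bad s)"
    using S3(3) finU card_mono[of "\<Union>s\<in>S3. ?bad s" U] by fastforce
  then obtain x where x: "x \<in> U" "\<forall>s\<in>S3. x + s \<in> U" by blast
  have "card ((\<lambda>s. x + s) ` S3) \<le> card {u \<in> U. link S x u}"
    using x S3(1) finU by (intro card_mono) (auto simp: link_def)
  moreover have "card ((\<lambda>s. x + s) ` S3) = 3" using S3(2) by (simp add: card_image inj_on_def)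
  ultimately show ?thesis using x(1) by metis
qed

text \<open>For two link elements this is the count of sets alternating along both. For at least three, vertices
  of degree 3 persist until only three quarters of the \<open>m = card V / 2\<close> vertices of the odd part are
  left; on the removed quarter the base \<open>sqrt 2\<close> improves to \<open>7/5\<close>, and \<open>(7/5)^2 = 2 * 98/100\<close>.\<close>

lemma card_mis_link_odd_le:
  assumes r: "r \<in> V" "r \<noteq> 0" and S: "sumfree S" "S \<subseteq> even_part r" "2 \<le> card S"
  shows "real (card (mis (link S) (odd_part r)))
    \<le> 2 powr (real (card V) / 6) + 2 powr (real (card V) / 4) * (98/100) powr (real (card V) / 16)"
proof (cases "card S = 2")
  case True
  then obtain s t where st: "S = {s, t}" "s \<noteq> t" by (meson card_2_iff)
  have "s \<noteq> 0" "t \<noteq> 0" using sumfree_zero[OF S(1)] st by auto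
  have "card (mis (link S) (odd_part r)) \<le> card (alternating r s \<inter> alternating r t)"
    using mis_link_pair[of s r t] S(2) st finite_alternating by (intro card_mono) auto
  also have "real \<dots> \<le> 2 powr (real (card V) / 6)"
    using card_alternating_Int_le[of s r t] S(2) st r \<open>s \<noteq> 0\<close> \<open>t \<noteq> 0\<close> by simp
  finally have "real (card (mis (link S) (odd_part r))) \<le> 2 powr (real (card V) / 6)" by simp
  moreover have "0 \<le> 2 powr (real (card V) / 4) * (98/100) powr (real (card V) / 16)" by simp
  ultimately show ?thesis by linarith
next
  case False
  interpret triangle_free_graph "link S" using S(1) by (rule triangle_free_link)
  let ?m = "card (odd_part r)"
  let ?w = "3 * ?m div 4"
  have m: "real ?m = real (card V) / 2" using card_odd_part[OF r] by linarith
  have "real (card (mis (link S) (odd_part r))) \<le> sqrt 2 ^ ?w * (7/5) ^ (?m - ?w)"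
  proof (rule card_mis_le_of_degree_ge_3)
    fix U assume "U \<subseteq> odd_part r" "?w < card U"
    then show "\<exists>v\<in>U. 3 \<le> card {u \<in> U. link S v u}"
      using False S sumfree_finite[OF S(1)] by (intro link_degree_ge_3) auto
  qed auto
  also have "\<dots> = sqrt 2 ^ ?m * (7/5 / sqrt 2) ^ (?m - ?w)"
  proof -
    have "?m = ?w + (?m - ?w)" by simp
    then have "sqrt 2 ^ ?m = sqrt 2 ^ ?w * sqrt 2 ^ (?m - ?w)" by (metis power_add)
    then show ?thesis by (simp add: power_divide)
  qed
  also have "(7/5 / sqrt 2) ^ (?m - ?w) \<le> (98/100) powr (real (card V) / 16)"
  proof -
    have "7/5 / sqrt 2 = sqrt (98/100)"
      by (rule real_sqrt_unique[symmetric]) (auto simp: power_divide power2_eq_square)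
    then have "(7/5 / sqrt 2) ^ (?m - ?w) = (98/100) powr (real (?m - ?w) / 2)"
      by (simp add: powr_half_sqrt[symmetric] powr_powr flip: powr_realpow)
    also have "\<dots> \<le> (98/100) powr (real (card V) / 16)"
    proof (rule powr_mono')
      have "?m \<le> 4 * (?m - ?w)" by linarith
      then have "real ?m \<le> 4 * real (?m - ?w)" by linarith
      then show "real (card V) / 16 \<le> real (?m - ?w) / 2" using m by linarith
    qed auto
    finally show ?thesis .
  qed
  also have "sqrt 2 ^ ?m = 2 powr (real (card V) / 4)" by (simp add: sqrt_2_power m)
  finally have "real (card (mis (link S) (odd_part r)))
      \<le> 2 powr (real (card V) / 4) * (98/100) powr (real (card V) / 16)"
    by (simp add: mult_left_mono)
  moreover have "0 \<le> 2 powr (real (card V) / 6)" by simp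
  ultimately show ?thesis by linarith
qed


section \<open>Counting maximal sum-free sets\<close>

text \<open>The periodic approximation \<open>B\<close> of \<open>A\<close> either has at most a third of all elements or lies in an
  odd part, and in the latter case all even elements of \<open>A\<close> are among the few outside \<open>B\<close>.\<close>

lemma msf_classification:
  assumes "msf A" and \<delta>: "0 < \<delta>" and J: "1 < real J * ((\<delta> ^ 3 / 2)\<^sup>2 * \<delta>)"
  shows "(\<exists>B \<in> periodic_sets (tower_bound J). sumfree B \<and> 3 * card B \<le> card V \<and> A - B \<in> small_sets (2 * \<delta>))
    \<or> (\<exists>r \<in> V - {0}. A \<inter> even_part r \<in> small_sets (2 * \<delta>))"
proof -
  note A = msf_sumfree[OF assms(1)]
  obtain B where B: "B \<in> periodic_sets (tower_bound J)" "sumfree B"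
    and le: "real (card (A - B)) \<le> 2 * \<delta> * real (card V)"
    using sumfree_structure[OF A \<delta> J] by blast
  have AV: "A \<subseteq> V" using A by (simp add: sumfree_def)
  then have small: "A - B \<in> small_sets (2 * \<delta>)" using le by (auto simp: small_sets_def)
  show ?thesis
  proof (cases "3 * card B \<le> card V")
    case True
    then show ?thesis using B small by blast
  next
    case False
    then obtain r where r: "r \<in> V" "r \<noteq> 0" "B \<subseteq> odd_part r"
      using sumfree_large_subset_odd_part[OF B(2)] by auto
    have "A \<inter> even_part r \<subseteq> A - B" using r(3) parts_partition(2)[of r] by blast
    then have "card (A \<inter> even_part r) \<le> card (A - B)"
      using sumfree_finite[OF A] by (intro card_mono) auto
    then have "A \<inter> even_part r \<in> small_sets (2 * \<delta>)"
      using le AV by (auto simp: small_sets_def)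
    then show ?thesis using r by blast
  qed
qed

text \<open>The families that carry the main term.\<close>

definition one_even :: "'a \<Rightarrow> 'a \<Rightarrow> 'a set set" where
  "one_even r s = {A. msf A \<and> A \<inter> even_part r = {s}}"

definition even_pairs :: "('a \<times> 'a) set" where
  "even_pairs = (SIGMA r : V - {0}. even_part r - {0})"

lemma even_pairsD:
  assumes "(r, s) \<in> even_pairs"
  shows "r \<in> V" "r \<noteq> 0" "s \<in> V" "s \<in> even_part r" "s \<noteq> 0"
  using assms by (auto simp: even_pairs_def even_part_def)

lemma finite_even_pairs: "finite even_pairs"
  using finite_V by (simp add: even_pairs_def)

lemma card_even_pairs: "card even_pairs = (card V - 1) choose 2"
proof -
  have "card even_pairs = (\<Sum>r\<in>V - {0}. card (even_part r - {0}))"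
    unfolding even_pairs_def using finite_V by (simp add: card_SigmaI)
  also have "\<dots> = (\<Sum>r\<in>V - {0}. (card V - 2) div 2)"
  proof (rule sum.cong[OF refl])
    fix r assume "r \<in> V - {0}"
    then have "2 * card (even_part r) = card V" by (simp add: card_even_part)
    moreover have "0 \<in> even_part r" by (simp add: even_part_def)
    ultimately show "card (even_part r - {0}) = (card V - 2) div 2" by simp
  qed
  also have "\<dots> = (card V - 1) * ((card V - 2) div 2)" using finite_V by simp
  also have "\<dots> = (card V - 1) choose 2"
  proof (cases "V - {0} = {}")
    case True
    then have "card V = 1" using zero_V by (metis Diff_eq_empty_iff card.empty card_insert_disjoint finite.emptyI insert_absorb2
          singleton_iff subset_antisym empty_iff One_nat_def empty_subsetI insert_subset)
    then show ?thesis by simp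
  next
    case False
    then obtain r where "r \<in> V" "r \<noteq> 0" by blast
    then have "even (card V)" using card_even_part[of r] by (metis dvd_triv_left)
    then have "even (card V - 2)" by simp
    moreover have "card V - 1 - 1 = card V - 2" by simp
    ultimately show ?thesis unfolding choose_two by (metis div_mult_swap)
  qed
  finally show ?thesis .
qed

lemma one_even_alternating:
  assumes "s \<in> even_part r" "A \<in> one_even r s"
  shows "A \<inter> odd_part r \<in> alternating r s"
  using assms msf_mis_odd[of A r] by (intro mis_link_singleton) (auto simp: one_even_def)

lemma msf_split: "msf A \<Longrightarrow> A = (A \<inter> odd_part r) \<union> (A \<inter> even_part r)"
  using parts_partition(1)[of r] by (auto simp: msf_def sumfree_def)

lemma finite_one_even: "finite (one_even r s)"
  unfolding one_even_def by (rule finite_msf)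

lemma card_one_even_le:
  assumes "(r, s) \<in> even_pairs"
  shows "real (card (one_even r s)) \<le> 2 powr (real (card V) / 4)"
proof (cases "one_even r s = {}")
  case False
  note rs = even_pairsD[OF assms]
  obtain A where "msf A" "s \<in> A" using False by (auto simp: one_even_def)
  then have "sumfree {s}" using sumfree_subset[OF msf_sumfree] by blast
  then interpret triangle_free_graph "link {s}" by (rule triangle_free_link)
  have "card (one_even r s) \<le> card (mis (link {s}) (odd_part r))"
  proof (rule card_inj_on_le)
    show "inj_on (\<lambda>A. A \<inter> odd_part r) (one_even r s)"
    proof (rule inj_onI)
      fix A B assume "A \<in> one_even r s" "B \<in> one_even r s" "A \<inter> odd_part r = B \<inter> odd_part r"
      then show "A = B" using msf_split[of A r] msf_split[of B r] by (simp add: one_even_def)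
    qed
    show "(\<lambda>A. A \<inter> odd_part r) ` one_even r s \<subseteq> mis (link {s}) (odd_part r)"
    proof (rule image_subsetI)
      fix A assume "A \<in> one_even r s"
      then show "A \<inter> odd_part r \<in> mis (link {s}) (odd_part r)"
        using msf_mis_odd[of A r] by (simp add: one_even_def)
    qed
  qed simp
  also have "real \<dots> \<le> sqrt 2 ^ card (odd_part r)" by (rule card_mis_le) simp
  also have "\<dots> = 2 powr (real (card V) / 4)"
  proof -
    have "real (card (odd_part r)) / 2 = real (card V) / 4" using card_odd_part[OF rs(1,2)] by linarith
    then show ?thesis by (simp only: sqrt_2_power)
  qed
  finally show ?thesis by simp
qed simp

text \<open>With \<open>S = A \<inter> even_part r\<close> empty, maximality leaves only the odd part itself; with at least two
  elements in \<open>S\<close>, the link graph on the odd part is far from a perfect matching.\<close>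

lemma card_few_even_le:
  assumes r: "r \<in> V" "r \<noteq> 0"
  shows "real (card {A. msf A \<and> A \<inter> even_part r \<in> small_sets \<epsilon> \<and> card (A \<inter> even_part r) \<noteq> 1})
    \<le> 1 + real (card (small_sets \<epsilon>)) * (2 powr (real (card V) / 6)
        + 2 powr (real (card V) / 4) * (98/100) powr (real (card V) / 16))"
    (is "real (card ?X) \<le> 1 + _ * ?c")
proof -
  let ?Q = "{S \<in> small_sets \<epsilon>. sumfree S \<and> S \<subseteq> even_part r \<and> 2 \<le> card S}"
  let ?F = "\<lambda>S. (\<lambda>I. I \<union> S) ` mis (link S) (odd_part r)"
  have finQ: "finite ?Q" using finite_small_sets by simp
  have "?X \<subseteq> {odd_part r} \<union> (\<Union>S\<in>?Q. ?F S)"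
  proof
    fix A assume A: "A \<in> ?X"
    let ?S = "A \<inter> even_part r"
    have split: "A = (A \<inter> odd_part r) \<union> ?S" using A msf_split by blast
    show "A \<in> {odd_part r} \<union> (\<Union>S\<in>?Q. ?F S)"
    proof (cases "?S = {}")
      case True
      then have "A \<subseteq> odd_part r" using split by blast
      then have "odd_part r = A" using A sumfree_odd_part[of r] unfolding msf_def by blast
      then show ?thesis by blast
    next
      case False
      then have "card ?S \<noteq> 0" by simp
      moreover have "card ?S \<noteq> 1" using A by blast
      ultimately have "2 \<le> card ?S" by linarith
      then have "?S \<in> ?Q" using A sumfree_subset[OF msf_sumfree, of A ?S] by auto
      moreover have "A \<inter> odd_part r \<in> mis (link ?S) (odd_part r)" using A msf_mis_odd by blast
      ultimately show ?thesis using split by blast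
    qed
  qed
  then have "card ?X \<le> card ({odd_part r} \<union> (\<Union>S\<in>?Q. ?F S))"
    by (rule card_mono[rotated]) (use finQ in auto)
  also have "\<dots> \<le> card {odd_part r} + card (\<Union>S\<in>?Q. ?F S)" by (rule card_Un_le)
  finally have "real (card ?X) \<le> 1 + real (card (\<Union>S\<in>?Q. ?F S))" by simp
  also have "real (card (\<Union>S\<in>?Q. ?F S)) \<le> real (card ?Q) * ?c"
  proof (rule card_UN_le_mult[OF finQ])
    fix S assume S: "S \<in> ?Q"
    have "card (?F S) \<le> card (mis (link S) (odd_part r))" by (simp add: card_image_le)
    also have "real \<dots> \<le> ?c" using S by (intro card_mis_link_odd_le r) auto
    finally show "real (card (?F S)) \<le> ?c" by simp
  qed
  also have "\<dots> \<le> real (card (small_sets \<epsilon>)) * ?c"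
    using finite_small_sets by (intro mult_right_mono) (auto intro!: card_mono)
  finally show ?thesis by simp
qed

text \<open>The first summand counts the sets with exactly one even element for some character; the second and
  third summands bound the two kinds of exceptional sets. The factor \<open>m\<close> stands for the choice of the
  few elements outside the container.\<close>

theorem card_msf_le:
  assumes \<delta>: "0 < \<delta>" and J: "1 < real J * ((\<delta> ^ 3 / 2)\<^sup>2 * \<delta>)"
  defines "K \<equiv> tower_bound J" and "m \<equiv> real (card (small_sets (2 * \<delta>)))" and "n \<equiv> real (card V)"
  shows "real (card {A. msf A}) \<le> real ((card V - 1) choose 2) * 2 powr (n / 4)
    + n ^ K * 2 ^ 2 ^ K * m * 2 powr (n / 6)
    + n * (1 + m * (2 powr (n / 6) + 2 powr (n / 4) * (98/100) powr (n / 16)))"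
proof -
  let ?\<epsilon> = "2 * \<delta>"
  let ?P = "periodic_sets K"
  let ?X = "{A. msf A \<and> (\<exists>B\<in>?P. sumfree B \<and> 3 * card B \<le> card V \<and> A - B \<in> small_sets ?\<epsilon>)}"
  let ?Y = "\<lambda>r. {A. msf A \<and> A \<inter> even_part r \<in> small_sets ?\<epsilon> \<and> card (A \<inter> even_part r) \<noteq> 1}"
  let ?Z = "\<lambda>(r, s). one_even r s"
  have "{A. msf A} \<subseteq> (\<Union>p\<in>even_pairs. ?Z p) \<union> ?X \<union> (\<Union>r\<in>V - {0}. ?Y r)"
  proof
    fix A assume "A \<in> {A. msf A}"
    then have A: "msf A" by simp
    have "A \<in> (\<Union>p\<in>even_pairs. ?Z p) \<or> A \<in> ?Y r" if r: "r \<in> V - {0}" "A \<inter> even_part r \<in> small_sets ?\<epsilon>" for r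
    proof (cases "card (A \<inter> even_part r) = 1")
      case True
      then obtain s where s: "A \<inter> even_part r = {s}" by (auto simp: card_1_singleton_iff)
      then have "s \<noteq> 0" using sumfree_zero[OF msf_sumfree[OF A]] by blast
      then have "(r, s) \<in> even_pairs" using r s by (auto simp: even_pairs_def)
      moreover have "A \<in> one_even r s" using A s by (simp add: one_even_def)
      ultimately show ?thesis by blast
    qed (use A r in blast)
    then show "A \<in> (\<Union>p\<in>even_pairs. ?Z p) \<union> ?X \<union> (\<Union>r\<in>V - {0}. ?Y r)"
      using msf_classification[OF A \<delta> J] A unfolding K_def by blast
  qed
  then have "card {A. msf A} \<le> card ((\<Union>p\<in>even_pairs. ?Z p) \<union> ?X \<union> (\<Union>r\<in>V - {0}. ?Y r))"
    by (rule card_mono[rotated]) (use finite_V finite_msf finite_even_pairs finite_one_even in auto)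
  also have "\<dots> \<le> card (\<Union>p\<in>even_pairs. ?Z p) + card ?X + card (\<Union>r\<in>V - {0}. ?Y r)"
    by (meson card_Un_le add_right_mono order_trans)
  finally have "real (card {A. msf A})
      \<le> real (card (\<Union>p\<in>even_pairs. ?Z p)) + real (card ?X) + real (card (\<Union>r\<in>V - {0}. ?Y r))"
    by linarith
  moreover have "real (card (\<Union>p\<in>even_pairs. ?Z p)) \<le> real ((card V - 1) choose 2) * 2 powr (n / 4)"
    unfolding card_even_pairs[symmetric] n_def
    by (rule card_UN_le_mult[OF finite_even_pairs]) (use card_one_even_le in auto)
  moreover have "real (card ?X) \<le> n ^ K * 2 ^ 2 ^ K * m * 2 powr (n / 6)"
  proof -
    have "real (card ?X) \<le> real (card ?P) * m * 2 powr (n / 6)"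
      unfolding m_def n_def using card_periodic_sets_le by (intro card_msf_near_small_le) blast
    also have "real (card ?P) \<le> n ^ K * 2 ^ 2 ^ K"
    proof -
      have "real (card ?P) \<le> real (card V ^ K * 2 ^ 2 ^ K)"
        using card_periodic_sets_le by (simp only: of_nat_le_iff)
      then show ?thesis by (simp add: n_def)
    qed
    finally show ?thesis by (simp add: mult_right_mono m_def)
  qed
  moreover have "real (card (\<Union>r\<in>V - {0}. ?Y r))
      \<le> n * (1 + m * (2 powr (n / 6) + 2 powr (n / 4) * (98/100) powr (n / 16)))"
  proof -
    have "real (card (\<Union>r\<in>V - {0}. ?Y r))
        \<le> real (card (V - {0})) * (1 + m * (2 powr (n / 6) + 2 powr (n / 4) * (98/100) powr (n / 16)))"
      unfolding m_def n_def
      by (rule card_UN_le_mult, simp add: finite_V, rule card_few_even_le) blast+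
    also have "\<dots> \<le> n * (1 + m * (2 powr (n / 6) + 2 powr (n / 4) * (98/100) powr (n / 16)))"
      unfolding n_def using finite_V by (intro mult_right_mono) (auto simp: m_def intro!: card_mono)
    finally show ?thesis .
  qed
  ultimately show ?thesis by linarith
qed

lemma sumfree_insert_alternating:
  assumes "s \<in> even_part r" "s \<noteq> 0" "I \<in> alternating r s"
  shows "sumfree (insert s I)"
  unfolding sumfree_def
proof (intro conjI ballI)
  have I: "I \<subseteq> odd_part r" and alt: "\<And>x. x \<in> odd_part r \<Longrightarrow> x \<in> I \<longleftrightarrow> x + s \<notin> I"
    using assms(3) by (auto simp: alternating_def)
  show "insert s I \<subseteq> V" using I assms(1) odd_part_subset by (auto simp: even_part_def)
  have chr_I: "chr r x = - 1" if "x \<in> I" for x using I that by (auto simp: odd_part_def)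
  have chr_s: "chr r s = 1" using assms(1) by (simp add: even_part_def)
  fix x y assume xy: "x \<in> insert s I" "y \<in> insert s I"
  show "x + y \<notin> insert s I"
  proof (cases "x = s \<or> y = s")
    case True
    then obtain z where z: "z \<in> insert s I" "x + y = z + s" using xy by (metis add.commute)
    show ?thesis
    proof (cases "z = s")
      case True
      then show ?thesis using z chr_I[of 0] assms(2) by auto
    next
      case False
      then have "z \<in> I" using z by blast
      then have "z \<noteq> 0" using chr_I[of 0] by auto
      have "z + s \<notin> I" using alt[of z] I \<open>z \<in> I\<close> by blast
      moreover have "z + s \<noteq> s" using \<open>z \<noteq> 0\<close> by simp
      ultimately show ?thesis using z(2) by simp
    qed
  next
    case False
    then have xyI: "x \<in> I" "y \<in> I" using xy by auto
    have "chr r (x + y) = 1" using xyI chr_I by (simp add: chr_add)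
    then have "x + y \<notin> I" using chr_I by fastforce
    moreover have "x + y \<noteq> s"
    proof
      assume "x + y = s"
      then have "y = x + s" by (metis add_self_left)
      then show False using alt[of x] xyI I by blast
    qed
    ultimately show ?thesis by blast
  qed
qed

text \<open>Every odd element outside \<open>I\<close> is \<open>s\<close> plus an element of \<open>I\<close>, so only an even element \<open>t\<close> can extend
  \<open>insert s I\<close>. Then \<open>I\<close> is independent for \<open>t\<close> as well, and since it alternates along \<open>s\<close> it contains
  half of the odd part, which makes it alternate along \<open>t\<close>.\<close>

lemma alternating_extends:
  assumes rs: "s \<in> even_part r" "s \<noteq> 0" and I: "I \<in> alternating r s"
  shows "insert s I \<in> one_even r s \<or> (\<exists>t \<in> even_part r. t \<noteq> 0 \<and> t \<noteq> s \<and> I \<in> alternating r t)"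
proof (cases "msf (insert s I)")
  case True
  have "insert s I \<inter> even_part r = {s}"
    using I rs parts_partition(2)[of r] by (auto simp: alternating_def)
  then show ?thesis using True by (simp add: one_even_def)
next
  case False
  have IO: "I \<subseteq> odd_part r" and alt: "\<And>x. x \<in> odd_part r \<Longrightarrow> x \<in> I \<longleftrightarrow> x + s \<notin> I"
    using I by (auto simp: alternating_def)
  obtain M where M: "sumfree M" "insert s I \<subseteq> M" "M \<noteq> insert s I"
    using False sumfree_insert_alternating[OF rs I] unfolding msf_def by blast
  then obtain t where t: "t \<in> M" "t \<noteq> s" "t \<notin> I" by blast
  have sM: "s \<in> M" and IM: "I \<subseteq> M" using M(2) by auto
  have "t \<in> V" "t \<noteq> 0" using M(1) t(1) sumfree_zero by (auto simp: sumfree_def)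
  have "t \<notin> odd_part r"
  proof
    assume "t \<in> odd_part r"
    then have "t + s \<in> M" using alt t(3) IM by blast
    then show False using M(1) t(1) sM by (auto simp: sumfree_def)
  qed
  then have te: "t \<in> even_part r" using \<open>t \<in> V\<close> parts_partition(1)[of r] by blast
  have "x \<in> I \<longleftrightarrow> x + t \<notin> I" if x: "x \<in> odd_part r" for x
  proof
    assume "x \<in> I"
    then show "x + t \<notin> I" using M(1) t(1) IM by (auto simp: sumfree_def)
  next
    assume nt: "x + t \<notin> I"
    show "x \<in> I"
    proof (rule ccontr)
      assume "x \<notin> I"
      then have "x + s \<in> I" using alt[OF x] by blast
      moreover have "x + t + s \<in> I" using alt[OF odd_part_add[OF te x]] nt by blast
      moreover have "x + s + t = x + t + s" by (simp add: ac_simps)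
      ultimately show False using M(1) t(1) IM by (metis sumfree_def subsetD)
    qed
  qed
  then have "I \<in> alternating r t" using IO by (simp add: alternating_def)
  then show ?thesis using te t(2) \<open>t \<noteq> 0\<close> by blast
qed

text \<open>All but few alternating sets \<open>I\<close> give a maximal sum-free set \<open>insert s I\<close>: the exceptions alternate
  along a second element \<open>t\<close>.\<close>

lemma card_one_even_ge:
  assumes "(r, s) \<in> even_pairs"
  shows "2 powr (real (card V) / 4) - real (card V) * 2 powr (real (card V) / 6) \<le> real (card (one_even r s))"
proof -
  note rs = even_pairsD[OF assms]
  let ?G = "{I \<in> alternating r s. insert s I \<in> one_even r s}"
  let ?T = "even_part r - {0, s}"
  have "alternating r s \<subseteq> ?G \<union> (\<Union>t\<in>?T. alternating r s \<inter> alternating r t)"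
    using alternating_extends[OF rs(4,5)] by blast
  then have "card (alternating r s) \<le> card (?G \<union> (\<Union>t\<in>?T. alternating r s \<inter> alternating r t))"
    by (rule card_mono[rotated]) (use finite_alternating in auto)
  also have "\<dots> \<le> card ?G + card (\<Union>t\<in>?T. alternating r s \<inter> alternating r t)" by (rule card_Un_le)
  also have "card ?G \<le> card (one_even r s)"
  proof (rule card_inj_on_le[OF _ _ finite_one_even])
    have "s \<notin> odd_part r" using rs(4) parts_partition(2)[of r] by blast
    then show "inj_on (insert s) ?G" by (intro inj_onI) (auto simp: alternating_def)
  qed auto
  finally have "real (card (alternating r s))
      \<le> real (card (one_even r s)) + real (card (\<Union>t\<in>?T. alternating r s \<inter> alternating r t))"
    by linarith
  also have "real (card (\<Union>t\<in>?T. alternating r s \<inter> alternating r t))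
      \<le> real (card ?T) * 2 powr (real (card V) / 6)"
    by (rule card_UN_le_mult) (use rs card_alternating_Int_le in auto)
  also have "\<dots> \<le> real (card V) * 2 powr (real (card V) / 6)"
    using finite_V by (intro mult_right_mono) (auto intro!: card_mono simp: even_part_def)
  finally show ?thesis using card_alternating_ge[OF rs(4,5,1,2)] by linarith
qed

definition doubly_one_even :: "'a set set" where
  "doubly_one_even = {A. \<exists>p\<in>even_pairs. \<exists>q\<in>even_pairs. p \<noteq> q \<and>
     A \<in> one_even (fst p) (snd p) \<and> A \<in> one_even (fst q) (snd q)}"

text \<open>Such a set has \<open>card V / 4 + 1\<close> elements, all of which except at most two lie in the intersection of
  two odd parts, which has \<open>card V / 4\<close> elements. So it is this intersection with two elements adjoined,
  up to the removal of at most one element.\<close>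

lemma card_doubly_one_even_le: "card doubly_one_even \<le> card V ^ 5"
proof -
  let ?F = "\<lambda>(r, s, r', s', x). insert s (insert s' (odd_part r \<inter> odd_part r')) - {x}"
  let ?D = "V \<times> V \<times> V \<times> V \<times> V"
  have "doubly_one_even \<subseteq> ?F ` ?D"
  proof
    fix A assume "A \<in> doubly_one_even"
    then obtain a b where ab: "a \<in> even_pairs" "b \<in> even_pairs" "a \<noteq> b"
      "A \<in> one_even (fst a) (snd a)" "A \<in> one_even (fst b) (snd b)"
      unfolding doubly_one_even_def by blast
    obtain r s r' s' where eq: "a = (r, s)" "b = (r', s')" by (cases a, cases b) blast
    have p: "(r, s) \<in> even_pairs" "(r', s') \<in> even_pairs" "(r, s) \<noteq> (r', s')"
      and A: "A \<in> one_even r s" "A \<in> one_even r' s'" using ab unfolding eq by simp_all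
    note rs = even_pairsD[OF p(1)] and rs' = even_pairsD[OF p(2)]
    have msf: "msf A" and E: "A \<inter> even_part r = {s}" "A \<inter> even_part r' = {s'}"
      using A by (auto simp: one_even_def)
    have "r \<noteq> r'" using E p(3) by auto
    let ?Q = "odd_part r \<inter> odd_part r'"
    let ?W = "insert s (insert s' ?Q)"
    have "A \<subseteq> ?W" using msf_split[OF msf, of r] msf_split[OF msf, of r'] E by blast
    have finA: "finite A" using sumfree_finite[OF msf_sumfree[OF msf]] .
    have "card A = card (A \<inter> odd_part r) + card (A \<inter> even_part r)"
      using msf_split[OF msf, of r] parts_partition(2)[of r] finA
      by (subst card_Un_disjoint[symmetric]) auto
    moreover have "2 * card (A \<inter> odd_part r) = card (odd_part r)"
      by (rule card_alternating_set[OF rs(4) one_even_alternating[OF rs(4) A(1)]])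
    ultimately have "card A = card ?Q + 1"
      using E(1) card_odd_part[OF rs(1,2)] card_odd_part_Int[OF rs(1,2) rs'(1,2) \<open>r \<noteq> r'\<close>] by simp
    moreover have "card ?W \<le> card ?Q + 2"
      using card_insert_le_m1 by (simp add: card_insert_if)
    ultimately have le1: "card (?W - A) \<le> 1" using finA \<open>A \<subseteq> ?W\<close> by (simp add: card_Diff_subset)
    have "0 \<notin> ?W" using rs(5) rs'(5) by (auto simp: odd_part_def)
    have "\<exists>x\<in>V. A = ?W - {x}"
    proof (cases "?W - A = {}")
      case True
      \<comment> \<open>Since 0 is not in \<open>?W\<close>, removing it stands for removing nothing.\<close>
      then have "A = ?W - {0}" using \<open>A \<subseteq> ?W\<close> \<open>0 \<notin> ?W\<close> by blast
      then show ?thesis using zero_V by blast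
    next
      case False
      moreover have "finite (?W - A)" by simp
      ultimately have "card (?W - A) \<noteq> 0" by (metis card_0_eq)
      then have "card (?W - A) = 1" using le1 by linarith
      then obtain x where x: "?W - A = {x}" by (auto simp: card_1_singleton_iff)
      then have "A = ?W - {x}" using \<open>A \<subseteq> ?W\<close> by blast
      moreover have "x \<in> ?W" using x by blast
      then have "x \<in> V" using rs(3) rs'(3) odd_part_subset[of r] by blast
      ultimately show ?thesis by blast
    qed
    then show "A \<in> ?F ` ?D" using rs(1,3) rs'(1,3) by force
  qed
  then have "card doubly_one_even \<le> card ?D" by (intro surj_card_le) (use finite_V in auto)
  also have "\<dots> = card V ^ 5" by (simp add: card_cartesian_product eval_nat_numeral)
  finally show ?thesis .
qed

text \<open>Discarding the sets counted more than once makes the families \<open>one_even r s\<close> disjoint.\<close>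

theorem card_msf_ge:
  defines "n \<equiv> real (card V)"
  shows "real ((card V - 1) choose 2) * (2 powr (n / 4) - n * 2 powr (n / 6) - n ^ 5) \<le> real (card {A. msf A})"
proof -
  let ?Z = "\<lambda>p. one_even (fst p) (snd p) - doubly_one_even"
  have finD: "finite doubly_one_even"
    by (rule finite_subset[OF _ finite_msf[of "\<lambda>_. True"]]) (auto simp: doubly_one_even_def one_even_def)
  have D: "real (card doubly_one_even) \<le> n ^ 5"
    using card_doubly_one_even_le unfolding n_def by (metis of_nat_le_iff of_nat_power)
  have Z: "2 powr (n / 4) - n * 2 powr (n / 6) - n ^ 5 \<le> real (card (?Z p))" if "p \<in> even_pairs" for p
  proof -
    have "card (one_even (fst p) (snd p)) \<le> card (?Z p) + card doubly_one_even"
      using diff_card_le_card_Diff[OF finD, of "one_even (fst p) (snd p)"] by linarith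
    moreover have "2 powr (n / 4) - n * 2 powr (n / 6) \<le> real (card (one_even (fst p) (snd p)))"
      unfolding n_def using that by (intro card_one_even_ge) simp
    ultimately show ?thesis using D by linarith
  qed
  have "real ((card V - 1) choose 2) * (2 powr (n / 4) - n * 2 powr (n / 6) - n ^ 5)
      = (\<Sum>p\<in>even_pairs. 2 powr (n / 4) - n * 2 powr (n / 6) - n ^ 5)"
    by (simp add: card_even_pairs)
  also have "\<dots> \<le> (\<Sum>p\<in>even_pairs. real (card (?Z p)))" by (rule sum_mono) (rule Z)
  also have "\<dots> = real (card (\<Union>p\<in>even_pairs. ?Z p))"
  proof (subst card_UN_disjoint)
    have "?Z p \<inter> ?Z q = {}" if "p \<in> even_pairs" "q \<in> even_pairs" "p \<noteq> q" for p q
      using that unfolding doubly_one_even_def by blast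
    then show "\<forall>p\<in>even_pairs. \<forall>q\<in>even_pairs. p \<noteq> q \<longrightarrow> ?Z p \<inter> ?Z q = {}" by blast
  qed (simp_all add: finite_even_pairs finite_one_even)
  also have "card (\<Union>p\<in>even_pairs. ?Z p) \<le> card {A. msf A}"
    by (rule card_mono) (use finite_msf[of "\<lambda>_. True"] in \<open>auto simp: one_even_def\<close>)
  finally show ?thesis by simp
qed

end

section \<open>Asymptotic estimates\<close>

text \<open>Give a subset \<open>S\<close> of \<open>V\<close> the weight \<open>x ^ card S\<close> with \<open>x = h / 2\<close>. All weights together sum to
  \<open>(1 + x) ^ card V\<close>, while each small set has weight at least \<open>(x powr \<epsilon>) ^ card V\<close>, and \<open>x powr \<epsilon>\<close> tends
  to 1 as \<open>\<epsilon>\<close> tends to 0.\<close>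

lemma card_small_subsets_le:
  assumes h: "0 < h" "h \<le> (1::real)"
  shows "\<exists>\<epsilon>>0. \<forall>V :: 'a set. finite V \<longrightarrow>
    real (card {S. S \<subseteq> V \<and> real (card S) \<le> \<epsilon> * real (card V)}) \<le> (1 + h) ^ card V"
proof -
  let ?x = "h / 2"
  define \<rho> where "\<rho> = (1 + h) / (1 + ?x)"
  \<comment> \<open>Chosen so that \<open>?x powr \<epsilon> = 1 / \<rho>\<close>, where \<open>(1 + ?x) *
    \<rho> = 1 + h\<close>.\<close>
  define \<epsilon> where "\<epsilon> = ln \<rho> / - ln ?x"
  have x: "0 < ?x" "?x < 1" using h by auto
  have lnx: "ln ?x < 0" using x by (simp only: ln_less_zero_iff)
  have \<rho>: "1 < \<rho>" using h by (simp add: \<rho>_def field_simps)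
  then have "0 < ln \<rho>" by simp
  then have \<epsilon>: "0 < \<epsilon>" unfolding \<epsilon>_def using lnx by (intro divide_pos_pos) auto
  have x\<epsilon>: "?x powr \<epsilon> = 1 / \<rho>"
  proof -
    have "?x powr \<epsilon> = exp (\<epsilon> * ln ?x)" using x by (simp add: powr_def)
    also have "\<epsilon> * ln ?x = - ln \<rho>" unfolding \<epsilon>_def using lnx by (simp only: divide_minus_right) simp
    also have "exp (- ln \<rho>) = 1 / \<rho>" using \<rho> by (simp add: exp_minus inverse_eq_divide)
    finally show ?thesis .
  qed
  show ?thesis
  proof (intro exI conjI allI impI)
    fix V :: "'a set" assume fin: "finite V"
    let ?n = "card V" and ?S = "{S. S \<subseteq> V \<and> real (card S) \<le> \<epsilon> * real (card V)}"
    have "real (card ?S) * (1 / \<rho>) ^ ?n = (\<Sum>S\<in>?S. ?x powr (\<epsilon> * real ?n))"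
      using x by (simp add: x\<epsilon>[symmetric] powr_powr[symmetric] powr_realpow)
    also have "\<dots> \<le> (\<Sum>S\<in>?S. ?x ^ card S)"
    proof (rule sum_mono)
      fix S assume "S \<in> ?S"
      then have "?x powr (\<epsilon> * real ?n) \<le> ?x powr real (card S)" using x by (intro powr_mono') auto
      then show "?x powr (\<epsilon> * real ?n) \<le> ?x ^ card S" using x by (simp add: powr_realpow)
    qed
    also have "\<dots> \<le> (\<Sum>S\<in>Pow V. ?x ^ card S)" by (rule sum_mono2) (use fin x in auto)
    also have "\<dots> = (1 + ?x) ^ ?n"
      using prod_add[OF fin, of "\<lambda>_. ?x" "\<lambda>_. 1"] by (simp add: add.commute)
    finally have "real (card ?S) * (1 / \<rho>) ^ ?n \<le> (1 + ?x) ^ ?n" .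
    then have "real (card ?S) \<le> (1 + ?x) ^ ?n * \<rho> ^ ?n"
      using \<rho> by (simp add: power_divide pos_divide_le_eq)
    also have "\<dots> = ((1 + ?x) * \<rho>) ^ ?n" by (simp only: power_mult_distrib)
    also have "(1 + ?x) * \<rho> = 1 + h" using x by (simp add: \<rho>_def)
    finally show "real (card ?S) \<le> (1 + h) ^ ?n" .
  qed (rule \<epsilon>)
qed

text \<open>With \<open>d\<close> the \<open>(j+1)\<close>-st root of \<open>c\<close>, the sequence is \<open>(n * d^n)^j * d^n\<close>.\<close>

lemma power_times_geometric_tendsto_0:
  assumes "0 < c" "c < (1::real)"
  shows "(\<lambda>n. real n ^ j * c ^ n) \<longlonglongrightarrow> 0"
proof -
  define d where "d = root (Suc j) c"
  have d: "0 < d" "d < 1" using assms by (simp_all add: d_def)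
  have dc: "d ^ Suc j = c" using assms by (simp add: d_def del: power_Suc)
  have "(\<lambda>n. real n * d ^ n) \<longlonglongrightarrow> 0" using d by (intro powser_times_n_limit_0) auto
  then have "(\<lambda>n. (real n * d ^ n) ^ j * d ^ n) \<longlonglongrightarrow> 0 ^ j * 0"
    using d by (intro tendsto_mult tendsto_power LIMSEQ_realpow_zero) auto
  moreover have "(real n * d ^ n) ^ j * d ^ n = real n ^ j * c ^ n" for n
  proof -
    have "(d ^ n) ^ Suc j = (d ^ Suc j) ^ n" by (metis power_mult mult.commute)
    then have "(d ^ n) ^ j * d ^ n = (d ^ Suc j) ^ n" by (simp only: power_Suc2)
    then show ?thesis unfolding dc by (simp add: power_mult_distrib mult.assoc)
  qed
  ultimately show ?thesis by simp
qed

text \<open>The base of the relative error: \<open>2 powr (-1/12)\<close> is the quotient of \<open>2 powr (n/6)\<close> and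
  \<open>2 powr (n/4)\<close> per element, the other entry of the maximum is the saving of \<open>card_mis_link_odd_le\<close>,
  and \<open>1001/1000\<close> pays for the choice of a small set. It is close enough to 1 to keep the product
  below 1.\<close>

definition decay :: real where
  "decay = 1001/1000 * max (2 powr (- 1 / 12)) ((98/100) powr (1 / 16))"

lemma decay_pos: "0 < decay"
  by (simp add: decay_def less_max_iff_disj)

lemma decay_less_1: "decay < 1"
proof -
  have 12: "(2 powr (- 1 / 12)) ^ 12 = (1 / 2 :: real)"
    by (subst powr_power) (simp_all add: powr_minus_divide)
  have 16: "((98/100) powr (1 / 16)) ^ 16 = (98/100 :: real)"
    by (subst powr_power) simp_all
  have "1001/1000 * 2 powr (- 1 / 12) < (1::real)"
  proof (rule power_less_imp_less_base[of _ 12])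
    show "(1001/1000 * 2 powr (- 1 / 12)) ^ 12 < (1::real) ^ 12"
      unfolding power_mult_distrib 12 by (simp add: eval_nat_numeral)
  qed simp
  moreover have "1001/1000 * (98/100) powr (1 / 16) < (1::real)"
  proof (rule power_less_imp_less_base[of _ 16])
    show "(1001/1000 * (98/100) powr (1 / 16)) ^ 16 < (1::real) ^ 16"
      unfolding power_mult_distrib 16 by (simp add: eval_nat_numeral)
  qed simp
  ultimately show ?thesis unfolding decay_def by (auto simp only: max_def split: if_split)
qed

context boolean_duality
begin

text \<open>The bounds \<open>card_msf_le\<close> and \<open>card_msf_ge\<close> divided by \<open>2 powr (n / 4)\<close>, with every error term put in
  the form of a power of \<open>n\<close> times \<open>decay ^ n\<close>.\<close>

theorem card_msf_approx:
  assumes \<delta>: "0 < \<delta>" and J: "1 < real J * ((\<delta> ^ 3 / 2)\<^sup>2 * \<delta>)"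
    and small: "real (card (small_sets (2 * \<delta>))) \<le> (1001/1000) ^ card V"
  defines "K \<equiv> tower_bound J" and "n \<equiv> card V"
  shows "\<bar>real (card {A. msf A}) / 2 powr (real n / 4) - real ((n - 1) choose 2)\<bar>
    \<le> (2 ^ 2 ^ K * real n ^ K + 3 * real n + real n ^ 3 + real n ^ 7) * decay ^ n"
proof -
  let ?t = "1001/1000 :: real"
  define a :: real where "a = 2 powr (- 1 / 12)"
  define b :: real where "b = (98/100) powr (1 / 16)"
  have ab: "0 \<le> a" "0 \<le> b" by (simp_all add: a_def b_def)
  define X where "X = 2 powr (real n / 4)"
  define m where "m = real (card (small_sets (2 * \<delta>)))"
  define N where "N = real n"
  define P where "P = real ((n - 1) choose 2)"
  define F where "F = real (card {A. msf A})"
  define D :: real where "D = 2 ^ 2 ^ K"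
  have X: "0 < X" by (simp add: X_def)
  have N: "0 \<le> N" by (simp add: N_def)
  have D: "0 \<le> D" by (simp add: D_def)
  have sixth: "2 powr (N / 6) = X * a ^ n"
  proof -
    have "a ^ n = 2 powr (- N / 12)" unfolding a_def by (subst powr_power) (simp_all add: N_def)
    moreover have "2 powr (N / 4) * 2 powr (- N / 12) = 2 powr (N / 6)" by (simp flip: powr_add)
    ultimately show ?thesis by (simp only: X_def N_def)
  qed
  have sixteenth: "(98/100) powr (N / 16) = b ^ n"
    unfolding b_def by (subst powr_power) (simp_all add: N_def)
  have "?t * a \<le> decay" "?t * b \<le> decay" unfolding decay_def a_def b_def by (intro mult_left_mono; simp)+
  then have ta: "?t ^ n * a ^ n \<le> decay ^ n" and tb: "?t ^ n * b ^ n \<le> decay ^ n"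
    using ab by (simp_all add: power_mono flip: power_mult_distrib)
  have m: "0 \<le> m" "m \<le> ?t ^ n" using small by (simp_all add: m_def n_def)
  have ma: "m * a ^ n \<le> decay ^ n" and mb: "m * b ^ n \<le> decay ^ n"
    using mult_right_mono[OF m(2), of "a ^ n"] mult_right_mono[OF m(2), of "b ^ n"] ta tb
      zero_le_power[OF ab(1), of n] zero_le_power[OF ab(2), of n] by linarith+
  have a: "a ^ n \<le> decay ^ n"
  proof -
    have "1 * a ^ n \<le> ?t ^ n * a ^ n" by (intro mult_right_mono one_le_power) (use ab in auto)
    then show ?thesis using ta by linarith
  qed
  \<comment> \<open>Absorbs the terms that carry no exponential factor.\<close>
  have one: "1 \<le> X * decay ^ n"
  proof -
    have "1 \<le> 2 powr (N / 6)" using N by (simp add: ge_one_powr_ge_zero)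
    also have "\<dots> \<le> X * decay ^ n" unfolding sixth using a X by (intro mult_left_mono) auto
    finally show ?thesis .
  qed
  have "F \<le> P * X + N ^ K * D * m * 2 powr (N / 6) + N * (1 + m * (2 powr (N / 6) + X * (98/100) powr (N / 16)))"
    using card_msf_le[OF \<delta> J] unfolding F_def P_def X_def N_def D_def m_def K_def n_def .
  also have "\<dots> = P * X + N ^ K * D * m * (X * a ^ n) + N * (1 + m * (X * a ^ n + X * b ^ n))"
    by (simp only: sixth sixteenth)
  also have "\<dots> = P * X + N ^ K * D * X * (m * a ^ n) + N * 1 + N * X * (m * a ^ n) + N * X * (m * b ^ n)"
    by (simp add: algebra_simps)
  also have "\<dots> \<le> P * X + N ^ K * D * X * decay ^ n + N * (X * decay ^ n) + N * X * decay ^ n + N * X * decay ^ n"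
    using N X D by (intro add_mono mult_left_mono ma mb one order_refl) auto
  also have "\<dots> = (P + (D * N ^ K + 3 * N) * decay ^ n) * X" by (simp add: algebra_simps)
  finally have "F \<le> (P + (D * N ^ K + 3 * N) * decay ^ n) * X" .
  then have "F / X \<le> P + (D * N ^ K + 3 * N) * decay ^ n" using X by (simp add: pos_divide_le_eq)
  moreover have "0 \<le> (N ^ 3 + N ^ 7) * decay ^ n" using N decay_pos by simp
  ultimately have upper: "F / X - P \<le> (D * N ^ K + 3 * N + N ^ 3 + N ^ 7) * decay ^ n"
    by (simp add: algebra_simps)
  have P: "0 \<le> P" "P \<le> N ^ 2"
  proof -
    have "(n - 1) choose 2 \<le> (n - 1) * (n - 1 - 1)" by (simp only: choose_two div_le_dividend)
    also have "\<dots> \<le> n ^ 2" unfolding power2_eq_square by (intro mult_mono) auto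
    finally show "P \<le> N ^ 2" unfolding P_def N_def by (metis of_nat_le_iff of_nat_power)
  qed (simp add: P_def)
  have "P * (X - N * 2 powr (N / 6) - N ^ 5) \<le> F"
    using card_msf_ge unfolding F_def P_def X_def N_def n_def .
  then have "P * X - P * (N * (X * a ^ n) + N ^ 5) \<le> F"
    unfolding sixth by (simp only: right_diff_distrib distrib_left diff_diff_eq)
  moreover have "P * (N * (X * a ^ n) + N ^ 5) \<le> N ^ 2 * (N * (X * decay ^ n) + N ^ 5 * (X * decay ^ n))"
  proof (intro mult_mono P add_mono mult_left_mono)
    show "N ^ 5 \<le> N ^ 5 * (X * decay ^ n)" using mult_left_mono[OF one, of "N ^ 5"] N by simp
  qed (use a ab N X decay_pos in auto)
  moreover have "N ^ 2 * (N * (X * decay ^ n) + N ^ 5 * (X * decay ^ n)) = (N ^ 3 + N ^ 7) * decay ^ n * X"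
    by (simp add: algebra_simps eval_nat_numeral)
  ultimately have "P * X - (N ^ 3 + N ^ 7) * decay ^ n * X \<le> F" by linarith
  then have "(P - (N ^ 3 + N ^ 7) * decay ^ n) * X \<le> F" by (simp only: left_diff_distrib)
  then have "P - (N ^ 3 + N ^ 7) * decay ^ n \<le> F / X" using X by (simp add: pos_le_divide_eq)
  moreover have "0 \<le> (D * N ^ K + 3 * N) * decay ^ n" using N D decay_pos by simp
  ultimately have lower: "- ((D * N ^ K + 3 * N + N ^ 3 + N ^ 7) * decay ^ n) \<le> F / X - P"
    by (simp add: algebra_simps)
  show ?thesis using upper lower unfolding F_def X_def P_def N_def D_def by linarith
qed

end

section \<open>The group of binary vectors\<close>

text \<open>The group of binary vectors of length \<open>k\<close>, realised as sequences that vanish from index \<open>k\<close> on; pointwise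
  addition is then a total group operation on one type that serves all \<open>k\<close>.\<close>

definition cube :: "nat \<Rightarrow> (nat \<Rightarrow> bit) set" where
  "cube k = {x. \<forall>i\<ge>k. x i = 0}"

text \<open>The character \<open>(-1)\<close> to the power of the scalar product of \<open>r\<close> and \<open>x\<close>.\<close>

definition pairing :: "nat \<Rightarrow> (nat \<Rightarrow> bit) \<Rightarrow> (nat \<Rightarrow> bit) \<Rightarrow> real" where
  "pairing k r x = (\<Prod>i<k. if r i = 1 \<and> x i = 1 then - 1 else 1)"

definition to_bits :: "nat \<Rightarrow> (nat \<Rightarrow> int) \<Rightarrow> nat \<Rightarrow> bit" where
  "to_bits k x = (\<lambda>i. if i < k \<and> x i = 1 then 1 else 0)"

lemma carrier_Z2_pow: "carrier (Z2_pow k) = (\<Pi>\<^sub>E i\<in>{..<k}. {0..<2})"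
  by (simp add: Z2_pow_def carrier_integer_mod_group)

lemma mult_Z2_pow: "x \<otimes>\<^bsub>Z2_pow k\<^esub> y = (\<lambda>i\<in>{..<k}. (x i + y i) mod 2)"
  by (simp add: Z2_pow_def integer_mod_group_def)

lemma Z2_pow_cases: "x \<in> carrier (Z2_pow k) \<Longrightarrow> i < k \<Longrightarrow> x i = 0 \<or> x i = 1"
  by (auto simp: carrier_Z2_pow PiE_def Pi_def dest!: spec[of _ i])

lemma to_bits_bij: "bij_betw (to_bits k) (carrier (Z2_pow k)) (cube k)"
proof (rule bij_betwI[of _ _ _ "\<lambda>x. \<lambda>i\<in>{..<k}. if x i = 1 then 1 else 0"])
  show "to_bits k \<in> carrier (Z2_pow k) \<rightarrow> cube k" by (auto simp: to_bits_def cube_def)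
  show "(\<lambda>x. \<lambda>i\<in>{..<k}. if x i = 1 then 1 else 0) \<in> cube k \<rightarrow> carrier (Z2_pow k)"
    by (auto simp: carrier_Z2_pow)
  show "(\<lambda>i\<in>{..<k}. if to_bits k x i = 1 then 1 else 0) = x" if "x \<in> carrier (Z2_pow k)" for x
  proof
    fix i
    show "(\<lambda>i\<in>{..<k}. if to_bits k x i = 1 then 1 else 0) i = x i"
      using that Z2_pow_cases[OF that, of i] by (auto simp: to_bits_def carrier_Z2_pow PiE_def extensional_def)
  qed
  show "to_bits k (\<lambda>i\<in>{..<k}. if x i = 1 then 1 else 0) = x" if "x \<in> cube k" for x
    using that by (auto simp: to_bits_def cube_def fun_eq_iff not_less)
qed

lemma to_bits_add:
  assumes "x \<in> carrier (Z2_pow k)" "y \<in> carrier (Z2_pow k)"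
  shows "to_bits k (x \<otimes>\<^bsub>Z2_pow k\<^esub> y) = to_bits k x + to_bits k y"
proof
  fix i
  show "to_bits k (x \<otimes>\<^bsub>Z2_pow k\<^esub> y) i = (to_bits k x + to_bits k y) i"
    using Z2_pow_cases[OF assms(1), of i] Z2_pow_cases[OF assms(2), of i]
    by (cases "i < k") (auto simp: to_bits_def mult_Z2_pow)
qed

lemma finite_carrier_Z2_pow: "finite (carrier (Z2_pow k))"
  by (auto simp: carrier_Z2_pow intro: finite_PiE)

lemma card_cube: "card (cube k) = 2 ^ k"
proof -
  have "card (cube k) = card (carrier (Z2_pow k))"
    using bij_betw_same_card[OF to_bits_bij] by simp
  then show ?thesis by (simp add: carrier_Z2_pow card_PiE)
qed

interpretation cube: boolean_duality "cube k" "pairing k"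
proof
  show "finite (cube k)" using bij_betw_finite[OF to_bits_bij] finite_carrier_Z2_pow by blast
  show "0 \<in> cube k" by (simp add: cube_def)
  show "x + y \<in> cube k" if "x \<in> cube k" "y \<in> cube k" for x y
    using that by (simp add: cube_def)
  show "x + x = 0" for x :: "nat \<Rightarrow> bit" by (simp add: fun_eq_iff)
  show "pairing k r x = 1 \<or> pairing k r x = - 1" for r x
  proof -
    have "(\<Prod>i\<in>S. if r i = 1 \<and> x i = 1 then - 1 else 1) \<in> {1, - 1 :: real}" if "finite S" for S
      using that by induction auto
    then show ?thesis by (simp add: pairing_def)
  qed
  show "pairing k r (x + y) = pairing k r x * pairing k r y" for r x y
  proof -
    have "(if a = 1 \<and> b + c = 1 then - 1 else 1 :: real)
        = (if a = 1 \<and> b = 1 then - 1 else 1) * (if a = 1 \<and> c = 1 then - 1 else 1)" for a b c :: bit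
      by (cases a; cases b; cases c) auto
    then show ?thesis unfolding pairing_def by (simp flip: prod.distrib)
  qed
  show "pairing k r x = pairing k x r" for r x
    unfolding pairing_def by (rule prod.cong) auto
  show "\<exists>r\<in>cube k. pairing k r x = - 1" if x: "x \<in> cube k" "x \<noteq> 0" for x
  proof -
    obtain j where j: "x j \<noteq> 0" using x(2) by (auto simp: fun_eq_iff)
    then have "j < k" using x(1) by (auto simp: cube_def not_less[symmetric])
    let ?e = "\<lambda>i. if i = j then 1 else 0 :: bit"
    have "pairing k ?e x = (\<Prod>i<k. if i = j then - 1 else 1)"
      unfolding pairing_def by (rule prod.cong) (use j in auto)
    also have "\<dots> = - 1" using \<open>j < k\<close> by simp
    finally show ?thesis using \<open>j < k\<close> by (intro bexI[of _ ?e]) (auto simp: cube_def)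
  qed
qed

lemma sum_free_Z2_pow_iff:
  assumes A: "A \<subseteq> carrier (Z2_pow k)"
  shows "sum_free (Z2_pow k) A \<longleftrightarrow> cube.sumfree k (to_bits k ` A)"
proof -
  have inj: "inj_on (to_bits k) (carrier (Z2_pow k))" and img: "to_bits k ` carrier (Z2_pow k) = cube k"
    using to_bits_bij by (auto simp: bij_betw_def)
  have closed: "x \<otimes>\<^bsub>Z2_pow k\<^esub> y \<in> carrier (Z2_pow k)" for x y
    by (auto simp: mult_Z2_pow carrier_Z2_pow)
  have key: "to_bits k x + to_bits k y \<in> to_bits k ` A \<longleftrightarrow> x \<otimes>\<^bsub>Z2_pow k\<^esub> y \<in> A"
    if "x \<in> A" "y \<in> A" for x y
  proof -
    have "to_bits k x + to_bits k y = to_bits k (x \<otimes>\<^bsub>Z2_pow k\<^esub> y)"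
      by (rule to_bits_add[symmetric]) (use that A in blast)+
    then show ?thesis by (simp only: inj_on_image_mem_iff[OF inj closed A])
  qed
  have "sum_free (Z2_pow k) A \<longleftrightarrow> (\<forall>x\<in>A. \<forall>y\<in>A. x \<otimes>\<^bsub>Z2_pow k\<^esub> y \<notin> A)"
    unfolding sum_free_def schur_triple_def using A by blast
  moreover have "to_bits k ` A \<subseteq> cube k" using A img by blast
  then have "cube.sumfree k (to_bits k ` A) \<longleftrightarrow> (\<forall>x\<in>A. \<forall>y\<in>A. to_bits k x + to_bits k y \<notin> to_bits k ` A)"
    unfolding cube.sumfree_def by (simp only: ball_simps simp_thms)
  ultimately show ?thesis using key by simp
qed

lemma f_max_Z2_pow: "f_max (Z2_pow k) = card {A. cube.msf k A}"
proof -
  let ?G = "carrier (Z2_pow k)"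
  have inj: "inj_on (to_bits k) ?G" and img: "to_bits k ` ?G = cube k"
    using to_bits_bij by (auto simp: bij_betw_def)
  have pre: "\<exists>B. B \<subseteq> ?G \<and> to_bits k ` B = C" if "C \<subseteq> cube k" for C
    using that img by (metis subset_imageE)
  have inj_img: "A = B" if "A \<subseteq> ?G" "B \<subseteq> ?G" "to_bits k ` A = to_bits k ` B" for A B
    using that inj by (metis inj_on_image_eq_iff)
  have mono: "A \<subseteq> B" if "A \<subseteq> ?G" "B \<subseteq> ?G" "to_bits k ` A \<subseteq> to_bits k ` B" for A B
    using inj_on_image_mem_iff[OF inj _ that(2)] that(1,3) by blast
  have iff: "maximal_sum_free (Z2_pow k) A \<longleftrightarrow> cube.msf k (to_bits k ` A)" if A: "A \<subseteq> ?G" for A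
  proof
    assume max: "maximal_sum_free (Z2_pow k) A"
    show "cube.msf k (to_bits k ` A)"
      unfolding cube.msf_def
    proof (intro conjI allI impI)
      show "cube.sumfree k (to_bits k ` A)"
        using max sum_free_Z2_pow_iff[OF A] by (simp add: maximal_sum_free_def)
      fix C assume C: "cube.sumfree k C \<and> to_bits k ` A \<subseteq> C"
      then have "C \<subseteq> cube k" by (simp add: cube.sumfree_def)
      from pre[OF this] obtain B where B: "B \<subseteq> ?G" "to_bits k ` B = C" by blast
      then have "sum_free (Z2_pow k) B" "A \<subseteq> B"
        using C sum_free_Z2_pow_iff[OF B(1)] mono[OF A B(1)] by simp_all
      then have "A = B" using max by (auto simp: maximal_sum_free_def)
      then show "C = to_bits k ` A" using B by simp
    qed
  next
    assume msf: "cube.msf k (to_bits k ` A)"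
    show "maximal_sum_free (Z2_pow k) A"
      unfolding maximal_sum_free_def
    proof (intro conjI notI)
      show "sum_free (Z2_pow k) A" using msf sum_free_Z2_pow_iff[OF A] by (simp add: cube.msf_def)
      assume "\<exists>B. sum_free (Z2_pow k) B \<and> A \<subset> B"
      then obtain B where B: "sum_free (Z2_pow k) B" "A \<subset> B" by blast
      then have BG: "B \<subseteq> ?G" by (simp add: sum_free_def)
      then have "to_bits k ` B = to_bits k ` A"
        using msf B sum_free_Z2_pow_iff[OF BG] unfolding cube.msf_def by (metis image_mono psubset_imp_subset)
      then show False using inj_img[OF BG A] B by blast
    qed
  qed
  have sub: "A \<subseteq> ?G" if "maximal_sum_free (Z2_pow k) A" for A
    using that by (simp add: maximal_sum_free_def sum_free_def)
  have "{A. cube.msf k A} = image (to_bits k) ` {A. maximal_sum_free (Z2_pow k) A}"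
  proof (intro Set.set_eqI iffI)
    fix C assume "C \<in> {A. cube.msf k A}"
    then have C: "cube.msf k C" by simp
    then have "C \<subseteq> cube k" by (simp add: cube.msf_def cube.sumfree_def)
    from pre[OF this] obtain B where "B \<subseteq> ?G" "to_bits k ` B = C" by blast
    then show "C \<in> image (to_bits k) ` {A. maximal_sum_free (Z2_pow k) A}" using C iff by blast
  qed (use iff sub in auto)
  moreover have "inj_on (image (to_bits k)) {A. maximal_sum_free (Z2_pow k) A}"
    using inj_img sub by (intro inj_onI) blast
  ultimately show ?thesis by (simp add: f_max_def card_image)
qed

theorem theorem1p2:
  shows "\<exists>\<epsilon> :: nat \<Rightarrow> real. \<epsilon> \<longlonglongrightarrow> 0 \<and>
    (\<forall>k :: nat. let n = (2 :: nat) ^ k in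
       real (f_max (Z2_pow k)) =
         (real ((n - 1) choose 2) + \<epsilon> k) * 2 powr (real n / 4))"
proof -
  obtain \<epsilon> where \<epsilon>: "0 < \<epsilon>" and small: "\<And>V :: (nat \<Rightarrow> bit) set. finite V \<Longrightarrow>
      real (card {S. S \<subseteq> V \<and> real (card S) \<le> \<epsilon> * real (card V)}) \<le> (1 + 1/1000) ^ card V"
    using card_small_subsets_le[of "1/1000", where 'a = "nat \<Rightarrow> bit"] by auto
  define \<delta> where "\<delta> = \<epsilon> / 2"
  have \<delta>: "0 < \<delta>" using \<epsilon> by (simp add: \<delta>_def)
  have "0 < (\<delta> ^ 3 / 2)\<^sup>2 * \<delta>" using \<delta> by simp
  then obtain J where J: "1 < real J * ((\<delta> ^ 3 / 2)\<^sup>2 * \<delta>)"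
    using reals_Archimedean3 by blast
  define K where "K = tower_bound J"
  define err where "err n = (2 ^ 2 ^ K * real n ^ K + 3 * real n + real n ^ 3 + real n ^ 7) * decay ^ n" for n
  define g where "g k = real (f_max (Z2_pow k)) / 2 powr (real (2 ^ k :: nat) / 4) - real ((2 ^ k - 1) choose 2)" for k
  have bound: "\<bar>g k\<bar> \<le> err (2 ^ k)" for k
  proof -
    have "real (card (cube.small_sets k (2 * \<delta>))) \<le> (1001/1000) ^ card (cube k)"
      using small[OF cube.finite_V[of k]] by (simp add: cube.small_sets_def \<delta>_def)
    from cube.card_msf_approx[OF \<delta> J this] show ?thesis
      by (simp add: g_def err_def f_max_Z2_pow card_cube K_def)
  qed
  have "(\<lambda>k. err (2 ^ k)) \<longlonglongrightarrow> 0"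
  proof -
    have *: "(\<lambda>n. real n ^ j * decay ^ n) \<longlonglongrightarrow> 0" for j
      by (rule power_times_geometric_tendsto_0[OF decay_pos decay_less_1])
    have "(\<lambda>n. 2 ^ 2 ^ K * (real n ^ K * decay ^ n) + 3 * (real n ^ 1 * decay ^ n)
        + real n ^ 3 * decay ^ n + real n ^ 7 * decay ^ n) \<longlonglongrightarrow> 2 ^ 2 ^ K * 0 + 3 * 0 + 0 + 0"
      by (intro tendsto_intros *)
    moreover have "err = (\<lambda>n. 2 ^ 2 ^ K * (real n ^ K * decay ^ n) + 3 * (real n ^ 1 * decay ^ n)
        + real n ^ 3 * decay ^ n + real n ^ 7 * decay ^ n)"
      by (simp add: fun_eq_iff err_def algebra_simps)
    ultimately have "err \<longlonglongrightarrow> 0" by simp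
    moreover have "strict_mono (\<lambda>k. 2 ^ k :: nat)" by (simp add: strict_mono_def)
    ultimately show ?thesis using LIMSEQ_subseq_LIMSEQ by (force simp: o_def)
  qed
  then have "g \<longlonglongrightarrow> 0"
    by (rule tendsto_0_le[of _ _ _ 1])
      (simp add: always_eventually order_trans[OF bound abs_ge_self])
  moreover have "real (f_max (Z2_pow k)) = (real ((2 ^ k - 1) choose 2) + g k) * 2 powr (real (2 ^ k :: nat) / 4)" for k
    by (simp add: g_def)
  ultimately show ?thesis by (intro exI[of _ g]) (simp add: Let_def)
qed

end
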